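(* Let $A$ be a Hausdorff space with no isolated point and $S$ a pseudogroup on $A$. Let $X$ be a Hausdorff $S$-modeled space. Let $H$ be a subgroup of $\mathrm{PC}^0_S(X)$ such that $X$ is transfixed under the partial $S$-preserving action $\alpha_S$ restricted to $H$. Then there exist cofinite subsets $Y\subset Y'$ of $X$ with $Y'$ $H$-invariant, and an $H$-invariant $S$-structure on $Y'$ (with its topology induced from $X$) that coincides with the original one on $Y$. In particular, if $H$ has no finite orbit on $X$, then $Y'=X$.
   Context: Partial homeomorphisms: $\mathcal{I}_{\mathrm{top}}(A,B)$ is the set of homeomorphisms between an open subset of $A$ and an open subset of $B$, viewed as subsets of $A\times B$; these compose as partial maps; $\mathcal{I}_{\mathrm{top}}(A)=\mathcal{I}_{\mathrm{top}}(A,A)$; $u\subset v$ means $v$ extends $u$. Pseudogroup: a pseudogroup on $A$ is a subset $S\subset\mathcal{I}_{\mathrm{top}}(A)$ containing $\mathrm{id}_A$, stable under composition and $u\mapsto u^{-1}$, such that $\{U:\mathrm{id}_U\in S\}$ is a basis of the topology of $A$. $\hat S$ is the set of elements of $\mathcal{I}_{\mathrm{top}}(A)$ that are unions of elements of $S$. An $S$-atlas on a topological space $X$ is a subset $\mathcal{H}\subset\mathcal{I}_{\mathrm{top}}(X,A)$ (charts), with $\emptyset\in\mathcal{H}$, whose domains cover $X$, such that $g\circ f^{-1}\in\hat S$ for all $f,g\in\mathcal{H}$. It is complete if $u\circ f\in\mathcal H$ for all $f\in\mathcal H$, $u\in S$, and every union of elements of $\mathcal{H}$ that belongs to $\mathcal{I}_{\mathrm{top}}(X,A)$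 is in $\mathcal{H}$. An $S$-structure on $X$ is a complete $S$-atlas (every $S$-atlas generates one), and $X$ is then called $S$-modeled. $\mathcal{I}_S(X)$, the set of $S$-preserving partial homeomorphisms, consists of elements of $\mathcal{I}_{\mathrm{top}}(X)$ that are unions of elements $g^{-1}\circ f$ with $f,g\in\mathcal{H}$. $\mathrm{PC}_S(X)$ is the group of $S$-preserving homeomorphisms between open cofinite subsets of $X$, two of these being identified when they agree on a cofinite subset. $\mathrm{PC}^0_S(X)$ is the subgroup of elements represented by a self-homeomorphism of $X$ (unique when $X$ is Hausdorff without isolated point); thus it acts on $X$. When $X$ is Hausdorff without isolated point, for $g\in\mathrm{PC}_S(X)$ the union $\alpha_S(g)$ (as subsets of $X^2$) of all $S$-preserving representatives of $g$ with open cofinite domain and range is itself a partial bijection, and $g\mapsto\alpha_S(g)$ is a partial action of $\mathrm{PC}_S(X)$ on $X$. Partial actions: a (topological) partial action of a discrete group $G$ on $X$ is a map $\alpha:G\to\mathcal{I}_{\mathrm{top}}(X)$ with $\alpha(1)=\mathrm{id}_X$, $\alpha(g^{-1})=\alpha(g)^{-1}$, $\alpha(g)\alpha(h)\subset\alpha(gh)$. Its universal globalization $\hat X$ is the quotient of $G\times X$ by the relation $(h,x)\sim(k,y)$ iff $\alpha(k^{-1}h)(x)$ is defined and equals $y$, with the $G$-action induced by $g\cdot(h,x)=(gh,x)$; $X$ embeds by $x\mapsto[(1,x)]$. $X$ is transfixed if there is a $G$-invariant subset $X_0\subset\hat X$ with $X\bigtriangleup X_0$ finite. *)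

theory Defs
  imports "HOL-Analysis.Analysis" "HOL-Algebra.Group"
begin

text \<open>
  Partial homeomorphisms are handled as their graphs, i.e. as relations: \<open>u \<subseteq> v\<close> means that
  \<open>v\<close> extends \<open>u\<close>, unions of partial homeomorphisms are unions of sets, and the
  inverse is the converse. As \<open>O\<close> composes from left to right, the partial map
  \<open>v \<circ> u\<close> is \<open>u O v\<close>. The identity of \<open>U\<close> is \<open>Id_on U\<close>.
\<close>

definition partial_homeos :: "'a topology \<Rightarrow> 'b topology \<Rightarrow> ('a \<times> 'b) set set" where
  "partial_homeos A B = {u. \<exists>U V f. openin A U \<and> openin B V \<and>
     homeomorphic_map (subtopology A U) (subtopology B V) f \<and> u = (\<lambda>x. (x, f x)) ` U}"

text \<open>The last condition says that the sets \<open>U\<close> with \<open>Id_on U \<in> S\<close> form a basis of the topology: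
  the open sets are exactly the unions of such sets.\<close>

definition pseudogroup :: "'a topology \<Rightarrow> ('a \<times> 'a) set set \<Rightarrow> bool" where
  "pseudogroup A S \<longleftrightarrow>
     S \<subseteq> partial_homeos A A \<and> Id_on (topspace A) \<in> S \<and>
     (\<forall>u\<in>S. \<forall>v\<in>S. u O v \<in> S) \<and> (\<forall>u\<in>S. u\<inverse> \<in> S) \<and>
     openin A = arbitrary union_of (\<lambda>U. Id_on U \<in> S)"

definition pseudogroup_hat :: "'a topology \<Rightarrow> ('a \<times> 'a) set set \<Rightarrow> ('a \<times> 'a) set set" where
  "pseudogroup_hat A S = {u \<in> partial_homeos A A. \<exists>C\<subseteq>S. u = \<Union>C}"

definition S_atlas ::
  "'a topology \<Rightarrow> ('a \<times> 'a) set set \<Rightarrow> 'x topology \<Rightarrow> ('x \<times> 'a) set set \<Rightarrow> bool" where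
  "S_atlas A S X \<H> \<longleftrightarrow>
     \<H> \<subseteq> partial_homeos X A \<and> {} \<in> \<H> \<and> (\<Union>f\<in>\<H>. Domain f) = topspace X \<and>
     (\<forall>f\<in>\<H>. \<forall>g\<in>\<H>. f\<inverse> O g \<in> pseudogroup_hat A S)"

definition complete_atlas ::
  "'a topology \<Rightarrow> ('a \<times> 'a) set set \<Rightarrow> 'x topology \<Rightarrow> ('x \<times> 'a) set set \<Rightarrow> bool" where
  "complete_atlas A S X \<H> \<longleftrightarrow>
     (\<forall>f\<in>\<H>. \<forall>u\<in>S. f O u \<in> \<H>) \<and>
     (\<forall>C\<subseteq>\<H>. \<Union>C \<in> partial_homeos X A \<longrightarrow> \<Union>C \<in> \<H>)"

definition S_structure ::
  "'a topology \<Rightarrow> ('a \<times> 'a) set set \<Rightarrow> 'x topology \<Rightarrow> ('x \<times> 'a) set set \<Rightarrow> bool" where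
  "S_structure A S X \<H> \<longleftrightarrow> S_atlas A S X \<H> \<and> complete_atlas A S X \<H>"

text \<open>The structure induced on an open subset \<open>Y\<close>. By completeness, cutting the charts down to
  \<open>Y\<close> gives the same set as keeping only the charts whose domain lies in \<open>Y\<close>.\<close>

definition structure_on :: "('x \<times> 'a) set set \<Rightarrow> 'x set \<Rightarrow> ('x \<times> 'a) set set" where
  "structure_on \<H> Y = {f \<in> \<H>. Domain f \<subseteq> Y}"

definition S_preserving :: "'x topology \<Rightarrow> ('x \<times> 'a) set set \<Rightarrow> ('x \<times> 'x) set set" where
  "S_preserving X \<H> = {u \<in> partial_homeos X X. \<exists>C\<subseteq>{f O g\<inverse> | f g. f \<in> \<H> \<and> g \<in> \<H>}. u = \<Union>C}"

definition cofinite_in :: "'x topology \<Rightarrow> 'x set \<Rightarrow> bool" where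
  "cofinite_in X W \<longleftrightarrow> W \<subseteq> topspace X \<and> finite (topspace X - W)"

definition agree_cofinitely :: "'x topology \<Rightarrow> ('x \<times> 'x) set \<Rightarrow> ('x \<times> 'x) set \<Rightarrow> bool" where
  "agree_cofinitely X u v \<longleftrightarrow>
     (\<exists>W. cofinite_in X W \<and> W \<subseteq> Domain u \<inter> Domain v \<and> (\<forall>x\<in>W. u `` {x} = v `` {x}))"

definition PC_reps :: "'x topology \<Rightarrow> ('x \<times> 'a) set set \<Rightarrow> ('x \<times> 'x) set set" where
  "PC_reps X \<H> = {u \<in> S_preserving X \<H>. cofinite_in X (Domain u) \<and> cofinite_in X (Range u)}"

definition PC_rel ::
  "'x topology \<Rightarrow> ('x \<times> 'a) set set \<Rightarrow> (('x \<times> 'x) set \<times> ('x \<times> 'x) set) set" where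
  "PC_rel X \<H> = {(u, v). u \<in> PC_reps X \<H> \<and> v \<in> PC_reps X \<H> \<and> agree_cofinitely X u v}"

definition PC :: "'x topology \<Rightarrow> ('x \<times> 'a) set set \<Rightarrow> ('x \<times> 'x) set set monoid" where
  "PC X \<H> =
     \<lparr>carrier = PC_reps X \<H> // PC_rel X \<H>,
      mult = (\<lambda>g h. \<Union>u\<in>g. \<Union>v\<in>h. PC_rel X \<H> `` {v O u}),
      one = PC_rel X \<H> `` {Id_on (topspace X)}\<rparr>"

definition self_homeos :: "'x topology \<Rightarrow> ('x \<times> 'x) set set" where
  "self_homeos X = {\<phi> \<in> partial_homeos X X. Domain \<phi> = topspace X \<and> Range \<phi> = topspace X}"

text \<open>A self-homeomorphism representing \<open>g\<close> agrees with the elements of the class \<open>g\<close> on a cofinite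
  subset, but need not be \<open>S\<close>-preserving at the remaining finitely many points (e.g. piecewise
  affine homeomorphisms of the circle); hence it need not itself belong to \<open>g\<close>.\<close>

definition represents :: "'x topology \<Rightarrow> ('x \<times> 'x) set set \<Rightarrow> ('x \<times> 'x) set \<Rightarrow> bool" where
  "represents X g \<phi> \<longleftrightarrow> \<phi> \<in> self_homeos X \<and> (\<exists>u\<in>g. agree_cofinitely X \<phi> u)"

definition PC0 :: "'x topology \<Rightarrow> ('x \<times> 'a) set set \<Rightarrow> ('x \<times> 'x) set set monoid" where
  "PC0 X \<H> = (PC X \<H>)\<lparr>carrier := {g \<in> carrier (PC X \<H>). \<exists>\<phi>. represents X g \<phi>}\<rparr>"

text \<open>The action of \<open>PC0\<close> on \<open>X\<close>; meaningful when \<open>X\<close> is Hausdorff without isolated points,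
  which makes the representing self-homeomorphism unique.\<close>

definition PC0_act :: "'x topology \<Rightarrow> ('x \<times> 'x) set set \<Rightarrow> ('x \<times> 'x) set" where
  "PC0_act X g = (THE \<phi>. represents X g \<phi>)"

text \<open>The class \<open>g\<close> is the set of all its \<open>S\<close>-preserving representatives with open cofinite domain
  and range.\<close>

definition alpha_S :: "('x \<times> 'x) set set \<Rightarrow> ('x \<times> 'x) set" where
  "alpha_S g = \<Union>g"

text \<open>Universal globalization of a partial action \<open>\<alpha>\<close> of \<open>G\<close> on \<open>X\<close> (as a \<open>G\<close>-set).\<close>

definition glob_rel ::
  "('g, 'm) monoid_scheme \<Rightarrow> 'x topology \<Rightarrow> ('g \<Rightarrow> ('x \<times> 'x) set) \<Rightarrow> (('g \<times> 'x) \<times> ('g \<times> 'x)) set" where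
  "glob_rel G X \<alpha> = {((h, x), (k, y)). h \<in> carrier G \<and> x \<in> topspace X \<and>
     k \<in> carrier G \<and> y \<in> topspace X \<and> (x, y) \<in> \<alpha> (inv\<^bsub>G\<^esub> k \<otimes>\<^bsub>G\<^esub> h)}"

definition globalization ::
  "('g, 'm) monoid_scheme \<Rightarrow> 'x topology \<Rightarrow> ('g \<Rightarrow> ('x \<times> 'x) set) \<Rightarrow> ('g \<times> 'x) set set" where
  "globalization G X \<alpha> = (carrier G \<times> topspace X) // glob_rel G X \<alpha>"

definition glob_act ::
  "('g, 'm) monoid_scheme \<Rightarrow> 'x topology \<Rightarrow> ('g \<Rightarrow> ('x \<times> 'x) set) \<Rightarrow>
     'g \<Rightarrow> ('g \<times> 'x) set \<Rightarrow> ('g \<times> 'x) set" where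
  "glob_act G X \<alpha> g c = (\<Union>(h, x)\<in>c. glob_rel G X \<alpha> `` {(g \<otimes>\<^bsub>G\<^esub> h, x)})"

definition glob_embed ::
  "('g, 'm) monoid_scheme \<Rightarrow> 'x topology \<Rightarrow> ('g \<Rightarrow> ('x \<times> 'x) set) \<Rightarrow> 'x \<Rightarrow> ('g \<times> 'x) set" where
  "glob_embed G X \<alpha> x = glob_rel G X \<alpha> `` {(\<one>\<^bsub>G\<^esub>, x)}"

definition transfixed ::
  "('g, 'm) monoid_scheme \<Rightarrow> 'x topology \<Rightarrow> ('g \<Rightarrow> ('x \<times> 'x) set) \<Rightarrow> bool" where
  "transfixed G X \<alpha> \<longleftrightarrow>
     (\<exists>X0 \<subseteq> globalization G X \<alpha>.
        (\<forall>g\<in>carrier G. glob_act G X \<alpha> g ` X0 = X0) \<and>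
        finite (sym_diff (glob_embed G X \<alpha> ` topspace X) X0))"

definition invariant_subset :: "'x topology \<Rightarrow> ('x \<times> 'x) set set set \<Rightarrow> 'x set \<Rightarrow> bool" where
  "invariant_subset X H Y \<longleftrightarrow> (\<forall>h\<in>H. PC0_act X h `` Y = Y)"

text \<open>For a structure on an \<open>H\<close>-invariant subset of \<open>X\<close>: \<open>\<K>\<close> equals its transport
  \<open>{f \<circ> \<phi>\<inverse> | f \<in> \<K>}\<close> by the action \<open>\<phi>\<close> of each element of \<open>H\<close>.\<close>

definition invariant_structure ::
  "'x topology \<Rightarrow> ('x \<times> 'x) set set set \<Rightarrow> ('x \<times> 'a) set set \<Rightarrow> bool" where
  "invariant_structure X H \<K> \<longleftrightarrow> (\<forall>h\<in>H. (\<lambda>f. (PC0_act X h)\<inverse> O f) ` \<K> = \<K>)"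

definition orbit_of :: "'x topology \<Rightarrow> ('x \<times> 'x) set set set \<Rightarrow> 'x \<Rightarrow> 'x set" where
  "orbit_of X H x = (\<Union>h\<in>H. PC0_act X h `` {x})"

end

theory Submission
  imports Defs
begin

text \<open>
  Each element of \<open>H\<close> acts by a unique self-homeomorphism \<open>\<phi>\<close> of \<open>X\<close>, and \<open>\<alpha>\<^sub>S\<close> restricts \<open>\<phi>\<close>
  to the points near which it preserves \<open>S\<close>. So \<open>p [(h, x)] = h x\<close> is a well-defined equivariant
  map from the globalization onto \<open>X\<close> that is the identity on the embedded copy of \<open>X\<close>.
  For an invariant \<open>X0\<close> at finite distance from \<open>X\<close>, all but finitely many fibres of \<open>p\<close> on \<open>X0\<close> are
  singletons; the points with a singleton fibre form the invariant cofinite set \<open>Y'\<close>. The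
  globalization inherits the structure of \<open>X\<close> sheet by sheet, and pushing it forward along
  \<open>p\<close> from \<open>X0\<close> gives the invariant structure on \<open>Y'\<close>. It agrees with the original one wherever
  the point of the fibre already lies in \<open>X\<close>.
\<close>

section \<open>Partial homeomorphisms as relations\<close>

lemma finite_Image_single_valued:
  assumes "single_valued r" "finite F"
  shows "finite (r `` F)"
proof -
  have "finite (r `` {x})" for x
  proof (cases "r `` {x} = {}")
    case False
    then obtain y where "y \<in> r `` {x}" by blast
    then have "r `` {x} \<subseteq> {y}" using assms(1) by (auto dest: single_valuedD)
    then show ?thesis by (rule finite_subset) simp
  qed simp
  moreover have "r `` F = (\<Union>x\<in>F. r `` {x})" by blast
  ultimately show ?thesis using assms(2) by simp
qed

text \<open>Continuity and openness become openness of images under \<open>u\<inverse>\<close> and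
  \<open>u\<close>; the domain and range are open as images of the whole spaces. This form is
  symmetric in \<open>u\<close> and \<open>u\<inverse>\<close>, so converses, composites and unions
  reduce to calculations with images.\<close>

lemma partial_homeos_iff:
  "u \<in> partial_homeos A B \<longleftrightarrow>
     single_valued u \<and> single_valued (u\<inverse>) \<and> u \<subseteq> topspace A \<times> topspace B \<and>
     (\<forall>U. openin A U \<longrightarrow> openin B (u `` U)) \<and> (\<forall>V. openin B V \<longrightarrow> openin A (u\<inverse> `` V))"
  (is "_ \<longleftrightarrow> ?R")
proof
  assume "u \<in> partial_homeos A B"
  then obtain U V f where U: "openin A U" and V: "openin B V"
    and h: "homeomorphic_map (subtopology A U) (subtopology B V) f"
    and u: "u = (\<lambda>x. (x, f x)) ` U"
    unfolding partial_homeos_def by blast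
  have sub: "U \<subseteq> topspace A" "V \<subseteq> topspace B" using U V by (auto dest: openin_subset)
  have ts: "topspace (subtopology A U) = U" "topspace (subtopology B V) = V"
    using sub by auto
  have inj: "inj_on f U" and im: "f ` U = V"
    using homeomorphic_imp_injective_map[OF h] homeomorphic_imp_surjective_map[OF h] ts by auto
  have op: "open_map (subtopology A U) (subtopology B V) f"
    and co: "continuous_map (subtopology A U) (subtopology B V) f"
    using h homeomorphic_imp_open_map homeomorphic_imp_continuous_map by auto
  have 1: "openin B (u `` W)" if W: "openin A W" for W
  proof -
    have "u `` W = f ` (U \<inter> W)" unfolding u by auto
    moreover have "openin (subtopology A U) (U \<inter> W)"
      using W openin_subtopology_Int2 by blast
    then have "openin (subtopology B V) (f ` (U \<inter> W))" using op by (simp add: open_map_def)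
    ultimately show ?thesis using V by (simp add: openin_open_subtopology)
  qed
  have 2: "openin A (u\<inverse> `` W)" if W: "openin B W" for W
  proof -
    have "u\<inverse> `` W = {x \<in> U. f x \<in> V \<inter> W}" unfolding u using im by auto
    moreover have "openin (subtopology B V) (V \<inter> W)"
      using W openin_subtopology_Int2 by blast
    then have "openin (subtopology A U) {x \<in> U. f x \<in> V \<inter> W}"
      using openin_continuous_map_preimage[OF co] ts by metis
    ultimately show ?thesis using U by (simp add: openin_open_subtopology)
  qed
  show ?R using 1 2 inj im sub unfolding u by (auto simp: single_valued_def dest: inj_onD)
next
  assume R: ?R
  \<comment> \<open>Outside \<open>Domain u\<close> the value of \<open>f\<close> is arbitrary;
    \<open>f\<close> is only ever used on \<open>Domain u\<close>.\<close>
  define f where "f x = (THE y. (x, y) \<in> u)" for x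
  have f: "f x = y" if "(x, y) \<in> u" for x y
    unfolding f_def using that R by (auto dest: single_valuedD)
  have u: "u = (\<lambda>x. (x, f x)) ` Domain u" using f by force
  have imf: "f ` W = u `` W" if "W \<subseteq> Domain u" for W using that f by force
  have inj: "inj_on f (Domain u)"
    using R f by (auto simp: inj_on_def single_valued_def)
  have "Domain u = u\<inverse> `` topspace B" "Range u = u `` topspace A" using R by auto
  then have U: "openin A (Domain u)" and V: "openin B (Range u)" using R by auto
  then have sub: "Domain u \<subseteq> topspace A" "Range u \<subseteq> topspace B" by (auto dest: openin_subset)
  have ts: "topspace (subtopology A (Domain u)) = Domain u"
    "topspace (subtopology B (Range u)) = Range u"
    using sub by auto
  have "homeomorphic_map (subtopology A (Domain u)) (subtopology B (Range u)) f"
  proof (rule bijective_open_imp_homeomorphic_map)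
    show "continuous_map (subtopology A (Domain u)) (subtopology B (Range u)) f"
      unfolding continuous_map ts
    proof (intro conjI allI impI)
      show "f ` Domain u \<subseteq> Range u" using imf by auto
      fix W assume "openin (subtopology B (Range u)) W"
      then have W: "openin B W" using V by (simp add: openin_open_subtopology)
      have "{x \<in> Domain u. f x \<in> W} = u\<inverse> `` W" using f by force
      then show "openin (subtopology A (Domain u)) {x \<in> Domain u. f x \<in> W}"
        using W R U by (auto simp: openin_open_subtopology)
    qed
    show "open_map (subtopology A (Domain u)) (subtopology B (Range u)) f"
      using R U V imf by (auto simp: open_map_def openin_open_subtopology)
    show "f ` topspace (subtopology A (Domain u)) = topspace (subtopology B (Range u))"
      unfolding ts using imf[of "Domain u"] by auto
    show "inj_on f (topspace (subtopology A (Domain u)))" unfolding ts by (rule inj)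
  qed
  then show "u \<in> partial_homeos A B"
    unfolding partial_homeos_def using U V u by blast
qed

lemma partial_homeos_sv: "u \<in> partial_homeos A B \<Longrightarrow> (x, y) \<in> u \<Longrightarrow> (x, z) \<in> u \<Longrightarrow> y = z"
  by (auto simp: partial_homeos_iff dest: single_valuedD)

lemma partial_homeos_inj: "u \<in> partial_homeos A B \<Longrightarrow> (x, z) \<in> u \<Longrightarrow> (y, z) \<in> u \<Longrightarrow> x = y"
  by (auto simp: partial_homeos_iff single_valued_def)

lemma partial_homeos_topspace:
  "u \<in> partial_homeos A B \<Longrightarrow> (x, y) \<in> u \<Longrightarrow> x \<in> topspace A \<and> y \<in> topspace B"
  by (auto simp: partial_homeos_iff)

lemma partial_homeos_subset: "u \<in> partial_homeos A B \<Longrightarrow> u \<subseteq> topspace A \<times> topspace B"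
  by (simp add: partial_homeos_iff)

lemma partial_homeos_openin_Range: "u \<in> partial_homeos A B \<Longrightarrow> openin B (Range u)"
proof -
  assume u: "u \<in> partial_homeos A B"
  then have "Range u = u `` topspace A" by (auto simp: partial_homeos_iff)
  then show ?thesis using u by (simp add: partial_homeos_iff)
qed

lemma partial_homeos_converse: "u \<in> partial_homeos A B \<Longrightarrow> u\<inverse> \<in> partial_homeos B A"
  unfolding partial_homeos_iff converse_converse by blast

lemma partial_homeos_relcomp:
  assumes "u \<in> partial_homeos A B" "v \<in> partial_homeos B C"
  shows "u O v \<in> partial_homeos A C"
proof -
  have "(u O v) `` W = v `` (u `` W)" "(u O v)\<inverse> `` W' = u\<inverse> `` (v\<inverse> `` W')" for W W'
    by blast+
  then show ?thesis using assms unfolding partial_homeos_iff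
    by (auto simp: single_valued_relcomp converse_relcomp)
qed

lemma partial_homeos_Id_on: "openin A U \<Longrightarrow> Id_on U \<in> partial_homeos A A"
proof -
  assume U: "openin A U"
  have "Id_on U `` W = U \<inter> W" for W by auto
  then show ?thesis unfolding partial_homeos_iff using U openin_subset[OF U]
    by (auto simp: single_valued_def)
qed

lemma partial_homeos_empty: "{} \<in> partial_homeos A B"
  by (simp add: partial_homeos_iff)

text \<open>Images commute with unions, so the only obstruction to gluing is single-valuedness in
  the two directions.\<close>

lemma partial_homeos_Union:
  assumes "\<And>u. u \<in> C \<Longrightarrow> u \<in> partial_homeos A B"
    and "single_valued (\<Union>C)" "single_valued ((\<Union>C)\<inverse>)"
  shows "\<Union>C \<in> partial_homeos A B"
proof -
  have "(\<Union>C) `` W = (\<Union>u\<in>C. u `` W)" "(\<Union>C)\<inverse> `` W' = (\<Union>u\<in>C. u\<inverse> `` W')" for W W' by blast+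
  moreover have "\<Union>C \<subseteq> topspace A \<times> topspace B" using assms(1) partial_homeos_subset by blast
  moreover have "openin B (\<Union>u\<in>C. u `` W)" if "openin A W" for W
    using assms(1) that by (intro openin_Union) (auto simp: partial_homeos_iff)
  moreover have "openin A (\<Union>u\<in>C. u\<inverse> `` W)" if "openin B W" for W
    using assms(1) that by (intro openin_Union) (auto simp: partial_homeos_iff)
  ultimately show ?thesis using assms(2,3) by (simp add: partial_homeos_iff)
qed

text \<open>Inside a fixed partial homeomorphism the obstruction to gluing vanishes, since subsets
  of single-valued relations are single-valued.\<close>

lemma partial_homeos_Union_subset:
  assumes "\<And>u. u \<in> C \<Longrightarrow> u \<in> partial_homeos A B" and "\<Union>C \<subseteq> \<phi>" "\<phi> \<in> partial_homeos A B"
  shows "\<Union>C \<in> partial_homeos A B"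
proof (rule partial_homeos_Union)
  have "(\<Union>C)\<inverse> \<subseteq> \<phi>\<inverse>" using assms(2) by blast
  then show "single_valued (\<Union>C)" "single_valued ((\<Union>C)\<inverse>)"
    using assms(2,3) single_valued_subset unfolding partial_homeos_iff by metis+
qed (use assms in auto)

text \<open>Lets a structure on an open subset be built from relations over all of \<open>X\<close>
  with a bound on the domain.\<close>

lemma partial_homeos_subtopology:
  assumes "openin X Y"
  shows "partial_homeos (subtopology X Y) A = {u \<in> partial_homeos X A. Domain u \<subseteq> Y}"
proof -
  have Y: "Y \<subseteq> topspace X" using assms by (rule openin_subset)
  have 1: "u \<in> partial_homeos X A" if u: "u \<in> partial_homeos (subtopology X Y) A" for u
  proof -
    have "Domain u \<subseteq> Y" using u Y by (auto simp: partial_homeos_iff)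
    then have "u `` W = u `` (Y \<inter> W)" for W by blast
    moreover have "openin (subtopology X Y) (Y \<inter> W)" if "openin X W" for W
      using that openin_subtopology_Int2 by blast
    ultimately have "openin A (u `` W)" if "openin X W" for W
      using that u unfolding partial_homeos_iff by metis
    moreover have "openin X (u\<inverse> `` V)" if "openin A V" for V
      using that u assms by (auto simp: partial_homeos_iff openin_open_subtopology)
    ultimately show ?thesis using u by (auto simp: partial_homeos_iff)
  qed
  have 2: "u \<in> partial_homeos (subtopology X Y) A" if "u \<in> partial_homeos X A" "Domain u \<subseteq> Y" for u
  proof -
    have "openin (subtopology X Y) (u\<inverse> `` V)" if "openin A V" for V
    proof -
      have "u\<inverse> `` V \<subseteq> Y" using \<open>Domain u \<subseteq> Y\<close> by blast
      then show ?thesis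
        using that \<open>u \<in> _\<close> assms by (simp add: openin_open_subtopology partial_homeos_iff)
    qed
    moreover have "openin A (u `` U)" if "openin (subtopology X Y) U" for U
      using that \<open>u \<in> _\<close> assms by (simp add: openin_open_subtopology partial_homeos_iff)
    moreover have "u \<subseteq> topspace (subtopology X Y) \<times> topspace A"
      using partial_homeos_subset[OF \<open>u \<in> _\<close>] \<open>Domain u \<subseteq> Y\<close> by auto
    ultimately show ?thesis using \<open>u \<in> _\<close> by (simp add: partial_homeos_iff)
  qed
  have "Domain u \<subseteq> Y" if "u \<in> partial_homeos (subtopology X Y) A" for u
    using partial_homeos_subset[OF that] by auto
  then show ?thesis using 1 2 by blast
qed

section \<open>Cofinite sets, agreement off a finite set, and self-homeomorphisms\<close>

lemma cofinite_openin:
  assumes "Hausdorff_space X" "cofinite_in X W"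
  shows "openin X W"
proof -
  have "closedin X (topspace X - W)"
    using assms by (intro closedin_Hausdorff_finite) (auto simp: cofinite_in_def)
  then show ?thesis using assms(2) by (metis closedin_def cofinite_in_def double_diff order_refl)
qed

lemma cofinite_mono:
  "cofinite_in X W \<Longrightarrow> W \<subseteq> W' \<Longrightarrow> W' \<subseteq> topspace X \<Longrightarrow> cofinite_in X W'"
  unfolding cofinite_in_def by (meson Diff_mono finite_subset order_refl)

lemma cofinite_Int: "cofinite_in X W \<Longrightarrow> cofinite_in X W' \<Longrightarrow> cofinite_in X (W \<inter> W')"
  unfolding cofinite_in_def by (auto simp: Diff_Int)

lemma agree_cofinitely_sym: "agree_cofinitely X u v \<Longrightarrow> agree_cofinitely X v u"
  unfolding agree_cofinitely_def by fastforce

lemma agree_cofinitely_trans: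
  assumes "agree_cofinitely X u v" "agree_cofinitely X v w"
  shows "agree_cofinitely X u w"
proof -
  obtain W W' where "cofinite_in X W" "W \<subseteq> Domain u \<inter> Domain v" "\<forall>x\<in>W. u `` {x} = v `` {x}"
    "cofinite_in X W'" "W' \<subseteq> Domain v \<inter> Domain w" "\<forall>x\<in>W'. v `` {x} = w `` {x}"
    using assms unfolding agree_cofinitely_def by blast
  then show ?thesis unfolding agree_cofinitely_def
    by (intro exI[of _ "W \<inter> W'"]) (auto simp: cofinite_Int)
qed

text \<open>The points newly lost in \<open>u O v\<close> are preimages under \<open>u\<close> of
  the finitely many points outside \<open>Domain v\<close>, and \<open>u\<close> is
  injective.\<close>

lemma cofinite_relcomp:
  assumes u: "u \<in> partial_homeos X X" and v: "v \<in> partial_homeos X X"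
    and "cofinite_in X (Domain u)" "cofinite_in X (Domain v)"
  shows "cofinite_in X (Domain (u O v))"
proof -
  have "finite (u\<inverse> `` (topspace X - Domain v))"
    using assms by (intro finite_Image_single_valued) (auto simp: partial_homeos_iff cofinite_in_def)
  moreover have "topspace X - Domain (u O v) \<subseteq> (topspace X - Domain u) \<union> u\<inverse> `` (topspace X - Domain v)"
    using partial_homeos_subset[OF u] partial_homeos_subset[OF v] by blast
  ultimately have "finite (topspace X - Domain (u O v))"
    using assms(3) unfolding cofinite_in_def by (meson finite_UnI finite_subset)
  moreover have "Domain (u O v) \<subseteq> topspace X" using u by (auto simp: partial_homeos_iff)
  ultimately show ?thesis unfolding cofinite_in_def by blast
qed

lemma self_homeosD:
  assumes "\<phi> \<in> self_homeos X"
  shows "\<phi> \<in> partial_homeos X X" "\<phi> O \<phi>\<inverse> = Id_on (topspace X)" "\<phi>\<inverse> O \<phi> = Id_on (topspace X)"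
    "\<And>x. x \<in> topspace X \<Longrightarrow> \<exists>y. (x, y) \<in> \<phi>" "\<And>y. y \<in> topspace X \<Longrightarrow> \<exists>x. (x, y) \<in> \<phi>"
proof -
  show ph: "\<phi> \<in> partial_homeos X X" using assms by (simp add: self_homeos_def)
  show 1: "\<And>x. x \<in> topspace X \<Longrightarrow> \<exists>y. (x, y) \<in> \<phi>" and 2: "\<And>y. y \<in> topspace X \<Longrightarrow> \<exists>x. (x, y) \<in> \<phi>"
    using assms by (auto simp: self_homeos_def)
  show "\<phi> O \<phi>\<inverse> = Id_on (topspace X)"
    using 1 partial_homeos_topspace[OF ph] partial_homeos_inj[OF ph] by (auto simp: Id_on_def) blast
  show "\<phi>\<inverse> O \<phi> = Id_on (topspace X)"
    using 2 partial_homeos_topspace[OF ph] partial_homeos_sv[OF ph] by (auto simp: Id_on_def) blast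
qed

lemma self_homeos_converse: "\<phi> \<in> self_homeos X \<Longrightarrow> \<phi>\<inverse> \<in> self_homeos X"
  by (auto simp: self_homeos_def partial_homeos_converse)

lemma self_homeos_relcomp:
  assumes "\<phi> \<in> self_homeos X" "\<psi> \<in> self_homeos X"
  shows "\<phi> O \<psi> \<in> self_homeos X"
proof -
  have "\<phi> O \<psi> \<in> partial_homeos X X"
    using assms by (auto intro: partial_homeos_relcomp self_homeosD)
  moreover have "topspace X \<subseteq> Domain (\<phi> O \<psi>)" "topspace X \<subseteq> Range (\<phi> O \<psi>)"
    using assms by (auto simp: self_homeos_def) blast+
  moreover have "Domain (\<phi> O \<psi>) \<subseteq> topspace X" "Range (\<phi> O \<psi>) \<subseteq> topspace X"
    using calculation(1) by (auto simp: partial_homeos_iff)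
  ultimately show ?thesis by (auto simp: self_homeos_def)
qed

lemma self_homeos_Id_on: "Id_on (topspace X) \<in> self_homeos X"
  by (auto simp: self_homeos_def partial_homeos_Id_on)

section \<open>Structures\<close>

locale S_modeled =
  fixes A :: "'a topology" and S :: "('a \<times> 'a) set set"
    and X :: "'x topology" and \<H> :: "('x \<times> 'a) set set"
  assumes no_isolated_A: "\<forall>a\<in>topspace A. \<not> openin A {a}"
    and pseudogroup: "pseudogroup A S"
    and Hausdorff: "Hausdorff_space X"
    and struct: "S_structure A S X \<H>"
begin

lemma chart_ph: "f \<in> \<H> \<Longrightarrow> f \<in> partial_homeos X A"
  using struct by (auto simp: S_structure_def S_atlas_def)

lemma chart_at: "x \<in> topspace X \<Longrightarrow> \<exists>f\<in>\<H>. \<exists>a. (x, a) \<in> f"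
  using struct unfolding S_structure_def S_atlas_def by blast

lemma transition: "f \<in> \<H> \<Longrightarrow> g \<in> \<H> \<Longrightarrow> f\<inverse> O g \<in> pseudogroup_hat A S"
  using struct by (auto simp: S_structure_def S_atlas_def)

text \<open>Membership in the completed pseudogroup is local: each local piece splits into elements
  of \<open>S\<close>, and the elements of \<open>S\<close> inside \<open>u\<close> fill
  \<open>u\<close>.\<close>

lemma hatI:
  assumes "u \<in> partial_homeos A A"
    and "\<And>a b. (a, b) \<in> u \<Longrightarrow> \<exists>v\<in>pseudogroup_hat A S. (a, b) \<in> v \<and> v \<subseteq> u"
  shows "u \<in> pseudogroup_hat A S"
proof -
  have "\<exists>s\<in>S. p \<in> s \<and> s \<subseteq> u" if p: "p \<in> u" for p
  proof -
    obtain v where "v \<in> pseudogroup_hat A S" "p \<in> v" "v \<subseteq> u"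
      using assms(2) p by (metis surj_pair)
    then show ?thesis unfolding pseudogroup_hat_def by blast
  qed
  then have "u = \<Union>{s \<in> S. s \<subseteq> u}" by blast
  moreover have "{s \<in> S. s \<subseteq> u} \<subseteq> S" by blast
  ultimately show ?thesis using assms(1) unfolding pseudogroup_hat_def by blast
qed

lemma hatE:
  assumes "u \<in> pseudogroup_hat A S" "(a, b) \<in> u"
  obtains s where "s \<in> S" "(a, b) \<in> s" "s \<subseteq> u"
  using assms unfolding pseudogroup_hat_def by blast

text \<open>Completeness under unions makes being a chart a local property: \<open>f\<close> is the
  union of the charts it contains.\<close>

lemma chartI:
  assumes "f \<in> partial_homeos X A"
    and "\<And>x a. (x, a) \<in> f \<Longrightarrow> \<exists>g\<in>\<H>. (x, a) \<in> g \<and> g \<subseteq> f"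
  shows "f \<in> \<H>"
proof -
  have "f = \<Union>{g \<in> \<H>. g \<subseteq> f}"
    by (intro equalityI subrelI) (use assms(2) in blast)+
  then show ?thesis using assms(1) struct unfolding S_structure_def complete_atlas_def
    by (metis (no_types, lifting) mem_Collect_eq subsetI)
qed

text \<open>Completeness only allows cutting charts on the target side, by elements of
  \<open>S\<close>. The open set \<open>Range f'\<close> is a union of sets \<open>U\<close> with
  \<open>Id_on U\<close> in \<open>S\<close>, and by injectivity of \<open>f\<close> each
  \<open>f O Id_on U\<close> lies inside \<open>f'\<close>.\<close>

lemma chart_restrict:
  assumes "f \<in> \<H>" "f' \<subseteq> f" "f' \<in> partial_homeos X A"
  shows "f' \<in> \<H>"
proof (rule chartI)
  fix x a assume xa: "(x, a) \<in> f'"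
  have "(arbitrary union_of (\<lambda>U. Id_on U \<in> S)) (Range f')"
    using pseudogroup partial_homeos_openin_Range[OF assms(3)] unfolding pseudogroup_def by metis
  then obtain U where U: "Id_on U \<in> S" "a \<in> U" "U \<subseteq> Range f'"
    using xa unfolding arbitrary_union_of_alt by (meson RangeI)
  have "f O Id_on U \<in> \<H>"
    using struct assms(1) U unfolding S_structure_def complete_atlas_def by blast
  moreover have "(x, a) \<in> f O Id_on U" using xa U assms(2) by blast
  moreover have "f O Id_on U \<subseteq> f'"
  proof (rule subrelI)
    fix z b assume "(z, b) \<in> f O Id_on U"
    then have "(z, b) \<in> f" "b \<in> Range f'" using U(3) by auto
    then obtain z' where z': "(z', b) \<in> f'" by blast
    then have "z' = z"
      using \<open>(z, b) \<in> f\<close> assms(2) partial_homeos_inj[OF chart_ph[OF assms(1)], of z' b z] by blast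
    then show "(z, b) \<in> f'" using z' by simp
  qed
  ultimately show "\<exists>g\<in>\<H>. (x, a) \<in> g \<and> g \<subseteq> f'" by metis
qed (rule assms(3))

text \<open>Closure under \<open>S\<close> extends to its completion because being a chart is
  local.\<close>

lemma chart_hat:
  assumes "f \<in> \<H>" "u \<in> pseudogroup_hat A S"
  shows "f O u \<in> \<H>"
proof (rule chartI)
  show "f O u \<in> partial_homeos X A"
    using assms chart_ph by (auto simp: pseudogroup_hat_def intro: partial_homeos_relcomp)
  fix x b assume "(x, b) \<in> f O u"
  then obtain a where a: "(x, a) \<in> f" "(a, b) \<in> u" by blast
  obtain s where s: "s \<in> S" "(a, b) \<in> s" "s \<subseteq> u" using hatE[OF assms(2) a(2)] .
  then have "f O s \<in> \<H>"
    using struct assms(1) unfolding S_structure_def complete_atlas_def by blast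
  then show "\<exists>g\<in>\<H>. (x, b) \<in> g \<and> g \<subseteq> f O u" using a s by blast
qed

section \<open>Structure-preserving partial homeomorphisms\<close>

abbreviation "SP \<equiv> S_preserving X \<H>"

lemma SP_ph: "u \<in> SP \<Longrightarrow> u \<in> partial_homeos X X"
  by (simp add: S_preserving_def)

text \<open>A working criterion: \<open>u\<close> preserves the structure when it pulls charts back
  to charts. For one direction, \<open>(f O f'\<inverse>) O g\<close> is \<open>f\<close> followed
  by a transition map; for the other, \<open>u\<close> is recovered from the pieces
  \<open>(u O g) O g\<inverse>\<close>.\<close>

lemma SP_iff: "u \<in> SP \<longleftrightarrow> u \<in> partial_homeos X X \<and> (\<forall>g\<in>\<H>. u O g \<in> \<H>)"
proof (intro iffI conjI ballI)
  fix g assume u: "u \<in> SP" and g: "g \<in> \<H>"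
  show "u O g \<in> \<H>"
  proof (rule chartI)
    show "u O g \<in> partial_homeos X A" using u g chart_ph SP_ph by (blast intro: partial_homeos_relcomp)
    fix x a assume "(x, a) \<in> u O g"
    then obtain y where y: "(x, y) \<in> u" "(y, a) \<in> g" by blast
    obtain C where C: "C \<subseteq> {f O g\<inverse> | f g. f \<in> \<H> \<and> g \<in> \<H>}" "u = \<Union>C"
      using u unfolding S_preserving_def by blast
    then obtain v where v: "v \<in> C" "(x, y) \<in> v" using y by blast
    then obtain f f' where "f \<in> \<H>" "f' \<in> \<H>" "v = f O f'\<inverse>" using C(1) by blast
    then have f: "f \<in> \<H>" "f' \<in> \<H>" "(x, y) \<in> f O f'\<inverse>" "f O f'\<inverse> \<subseteq> u" using C v by auto
    have "(f O f'\<inverse>) O g \<in> \<H>" using f g chart_hat transition by (simp add: O_assoc)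
    moreover have "(x, a) \<in> (f O f'\<inverse>) O g" using f(3) y(2) by (rule relcompI)
    moreover have "(f O f'\<inverse>) O g \<subseteq> u O g" using f(4) by (rule relcomp_mono) simp
    ultimately show "\<exists>h\<in>\<H>. (x, a) \<in> h \<and> h \<subseteq> u O g" by metis
  qed
next
  assume u: "u \<in> partial_homeos X X \<and> (\<forall>g\<in>\<H>. u O g \<in> \<H>)"
  define P where "P = {f O g\<inverse> | f g. f \<in> \<H> \<and> g \<in> \<H>}"
  have "\<exists>v\<in>P. p \<in> v \<and> v \<subseteq> u" if p: "p \<in> u" for p
  proof -
    obtain x y where xy: "p = (x, y)" by (rule prod.exhaust)
    then have "y \<in> topspace X" using partial_homeos_topspace[of u X X x y] u p by simp
    then obtain g a where g: "g \<in> \<H>" "(y, a) \<in> g" using chart_at by blast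
    have "(u O g) O g\<inverse> \<subseteq> u"
    proof (rule subrelI)
      fix z w assume "(z, w) \<in> (u O g) O g\<inverse>"
      then obtain y' b where "(z, y') \<in> u" "(y', b) \<in> g" "(w, b) \<in> g" by blast
      then show "(z, w) \<in> u" using partial_homeos_inj[OF chart_ph[OF g(1)], of y' b w] by simp
    qed
    moreover have "u O g \<in> \<H>" using u g(1) by simp
    then have "(u O g) O g\<inverse> \<in> P"
      unfolding P_def using g(1) by (intro CollectI exI[of _ "u O g"] exI[of _ g] conjI refl)
    moreover have "p \<in> (u O g) O g\<inverse>"
      unfolding xy using p xy g(2) by (intro relcompI converseI) auto
    ultimately show ?thesis by metis
  qed
  then have "u = \<Union>{v \<in> P. v \<subseteq> u}" by blast
  moreover have "{v \<in> P. v \<subseteq> u} \<subseteq> P" by blast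
  ultimately have "\<exists>C\<subseteq>P. u = \<Union>C" by (intro exI[of _ "{v \<in> P. v \<subseteq> u}"] conjI)
  then show "u \<in> SP" using u by (simp add: S_preserving_def P_def)
qed (simp add: SP_ph)

lemma SP_relcomp: "u \<in> SP \<Longrightarrow> v \<in> SP \<Longrightarrow> u O v \<in> SP"
  by (auto simp: SP_iff O_assoc intro: partial_homeos_relcomp)

lemma SP_converse:
  assumes "u \<in> SP" shows "u\<inverse> \<in> SP"
proof -
  obtain C where C: "C \<subseteq> {f O g\<inverse> | f g. f \<in> \<H> \<and> g \<in> \<H>}" "u = \<Union>C"
    using assms unfolding S_preserving_def by blast
  have "u\<inverse> = \<Union>(converse ` C)" using C(2) by auto
  moreover have "converse ` C \<subseteq> {f O g\<inverse> | f g. f \<in> \<H> \<and> g \<in> \<H>}"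
  proof
    fix v assume "v \<in> converse ` C"
    then obtain f g where "f \<in> \<H>" "g \<in> \<H>" "v = (f O g\<inverse>)\<inverse>" using C(1) by blast
    then show "v \<in> {f O g\<inverse> | f g. f \<in> \<H> \<and> g \<in> \<H>}"
      unfolding converse_relcomp converse_converse by blast
  qed
  moreover have "u\<inverse> \<in> partial_homeos X X"
    using assms by (simp add: S_preserving_def partial_homeos_converse)
  ultimately show ?thesis unfolding S_preserving_def by blast
qed

lemma SP_Id: "Id_on (topspace X) \<in> SP"
proof -
  have "Id_on (topspace X) O g = g" if "g \<in> \<H>" for g
    using partial_homeos_subset[OF chart_ph[OF that]] by blast
  then show ?thesis by (simp add: SP_iff partial_homeos_Id_on)
qed

lemma SP_Union_subset:
  assumes "C \<subseteq> SP" "\<Union>C \<subseteq> \<phi>" "\<phi> \<in> partial_homeos X X"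
  shows "\<Union>C \<in> SP"
proof -
  have ph: "\<Union>C \<in> partial_homeos X X"
    using assms SP_ph by (intro partial_homeos_Union_subset) auto
  have "\<Union>C O g \<in> \<H>" if g: "g \<in> \<H>" for g
  proof (rule chartI)
    show "\<Union>C O g \<in> partial_homeos X A" using ph g chart_ph by (blast intro: partial_homeos_relcomp)
    fix x a assume "(x, a) \<in> \<Union>C O g"
    then obtain u where "u \<in> C" "(x, a) \<in> u O g" by blast
    then show "\<exists>h\<in>\<H>. (x, a) \<in> h \<and> h \<subseteq> \<Union>C O g"
      using assms(1) g by (intro bexI[of _ "u O g"]) (auto simp: SP_iff)
  qed
  then show ?thesis using ph by (simp add: SP_iff)
qed

section \<open>Density of cofinite sets and uniqueness of extensions\<close>

lemma no_isolated: "\<not> openin X {x}"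
proof
  assume x: "openin X {x}"
  then have "x \<in> topspace X" using openin_subset by blast
  then obtain f a where f: "f \<in> \<H>" "(x, a) \<in> f" using chart_at by blast
  have "f `` {x} = {a}" using f partial_homeos_sv[OF chart_ph] by blast
  then have "openin A {a}" using x chart_ph[OF f(1)] by (metis partial_homeos_iff)
  then show False using no_isolated_A openin_subset by blast
qed

text \<open>Otherwise the open set would be finite, and in a Hausdorff space each of its points
  would be isolated.\<close>

lemma open_meets_cofinite:
  assumes "openin X U" "x \<in> U" "cofinite_in X W"
  shows "\<exists>w. w \<in> U \<inter> W"
proof (rule ccontr)
  assume "\<nexists>w. w \<in> U \<inter> W"
  then have "U \<subseteq> topspace X - W" using openin_subset[OF assms(1)] by blast
  then have "finite U" using assms(3) finite_subset unfolding cofinite_in_def by blast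
  then have "closedin X (U - {x})"
    using openin_subset[OF assms(1)] by (intro closedin_Hausdorff_finite[OF Hausdorff]) auto
  with assms(1) have "openin X (U - (U - {x}))" by (rule openin_diff)
  moreover have "U - (U - {x}) = {x}" using assms(2) by blast
  ultimately show False using no_isolated by simp
qed

text \<open>If \<open>u\<close> and \<open>\<phi>\<close> differed at one point, separating the two
  values would make them differ on a whole neighbourhood, which meets the cofinite set of agreement.
  Equality off a finite set thus becomes inclusion of graphs.\<close>

lemma agree_imp_subset:
  assumes \<phi>: "\<phi> \<in> self_homeos X" and u: "u \<in> partial_homeos X X" and "agree_cofinitely X \<phi> u"
  shows "u \<subseteq> \<phi>"
proof (rule subrelI, rule ccontr)
  fix x y assume xy: "(x, y) \<in> u" "(x, y) \<notin> \<phi>"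
  have ph: "\<phi> \<in> partial_homeos X X" using \<phi> by (rule self_homeosD)
  obtain W where W: "cofinite_in X W" "\<forall>x\<in>W. \<phi> `` {x} = u `` {x}"
    using assms(3) unfolding agree_cofinitely_def by blast
  have ts: "x \<in> topspace X" "y \<in> topspace X" using partial_homeos_topspace[OF u xy(1)] by auto
  then obtain z where z: "(x, z) \<in> \<phi>" using self_homeosD(4)[OF \<phi>] by blast
  then have "z \<in> topspace X" "z \<noteq> y" using partial_homeos_topspace[OF ph] xy by auto
  then obtain V V' where V: "openin X V" "openin X V'" "y \<in> V" "z \<in> V'" "disjnt V V'"
    using Hausdorff ts unfolding Hausdorff_space_def by metis
  have "openin X (u\<inverse> `` V \<inter> \<phi>\<inverse> `` V')" using V u ph by (auto simp: partial_homeos_iff)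
  moreover have "x \<in> u\<inverse> `` V \<inter> \<phi>\<inverse> `` V'" using V xy z by blast
  ultimately obtain w where w: "w \<in> u\<inverse> `` V \<inter> \<phi>\<inverse> `` V' \<inter> W"
    using open_meets_cofinite[OF _ _ W(1)] by blast
  then obtain p q where "(w, p) \<in> u" "p \<in> V" "(w, q) \<in> \<phi>" "q \<in> V'" by blast
  moreover then have "(w, p) \<in> \<phi>" using W w by blast
  ultimately show False using V partial_homeos_sv[OF ph] unfolding disjnt_def by blast
qed

lemma subset_imp_agree:
  assumes "\<phi> \<in> partial_homeos X X" "u \<subseteq> \<phi>" "cofinite_in X (Domain u)"
  shows "agree_cofinitely X \<phi> u"
proof -
  have "\<forall>x\<in>Domain u. \<phi> `` {x} = u `` {x}"
    using assms(2) partial_homeos_sv[OF assms(1)] by blast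
  then show ?thesis using assms(2,3) unfolding agree_cofinitely_def by blast
qed

text \<open>For a partial homeomorphism \<open>\<phi>\<close> of \<open>X\<close> this is its
  largest structure-preserving restriction, defined at the points near which \<open>\<phi>\<close>
  preserves the structure. For \<open>\<phi>\<close> in \<open>pieces\<close> it turns out to be the
  value of \<open>alpha_S\<close> on the class of \<open>\<phi>\<close>.\<close>

definition reg :: "('x \<times> 'x) set \<Rightarrow> ('x \<times> 'x) set" where
  "reg \<phi> = \<Union>{u \<in> SP. u \<subseteq> \<phi>}"

lemma reg_subset: "reg \<phi> \<subseteq> \<phi>"
  unfolding reg_def by blast

lemma regI: "u \<in> SP \<Longrightarrow> u \<subseteq> \<phi> \<Longrightarrow> p \<in> u \<Longrightarrow> p \<in> reg \<phi>"
  unfolding reg_def by blast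

lemma regE:
  assumes "p \<in> reg \<phi>" obtains u where "u \<in> SP" "u \<subseteq> \<phi>" "p \<in> u"
  using assms unfolding reg_def by blast

lemma reg_converse: "(x, y) \<in> reg \<phi> \<Longrightarrow> (y, x) \<in> reg (\<phi>\<inverse>)"
  by (elim regE, rule regI[OF SP_converse]) auto

lemma reg_relcomp:
  assumes "(x, y) \<in> reg \<phi>" "(y, z) \<in> reg \<psi>"
  shows "(x, z) \<in> reg (\<phi> O \<psi>)"
proof -
  obtain u v where "u \<in> SP" "u \<subseteq> \<phi>" "(x, y) \<in> u" "v \<in> SP" "v \<subseteq> \<psi>" "(y, z) \<in> v"
    using assms by (elim regE) blast
  then show ?thesis by (intro regI[of "u O v"] SP_relcomp relcomp_mono relcompI)
qed

text \<open>Regularity of \<open>\<phi>\<close> is known only near \<open>x\<close>, so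
  \<open>\<phi> O f\<close> itself may fail to be a chart; a smaller piece through \<open>x\<close>
  is one.\<close>

lemma chart_pull:
  assumes "(x, y) \<in> reg \<phi>" "f \<in> \<H>" "(y, a) \<in> f"
  shows "\<exists>f'\<in>\<H>. (x, a) \<in> f' \<and> f' \<subseteq> \<phi> O f"
proof -
  obtain u where u: "u \<in> SP" "u \<subseteq> \<phi>" "(x, y) \<in> u" using assms(1) by (elim regE)
  then have "u O f \<in> \<H>" using assms(2) SP_iff by blast
  moreover have "(x, a) \<in> u O f" using u(3) assms(3) by (rule relcompI)
  moreover have "u O f \<subseteq> \<phi> O f" using u(2) by (rule relcomp_mono) simp
  ultimately show ?thesis by metis
qed

section \<open>The group of piecewise structure-preserving homeomorphisms\<close>

text \<open>An element of \<open>PC0\<close> is the set of all its representatives contained in its unique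
  self-homeomorphism, so \<open>PC0\<close> is identified with the group \<open>pieces\<close> of self-homeomorphisms
  (with the opposite of relational composition).\<close>

definition cls :: "('x \<times> 'x) set \<Rightarrow> ('x \<times> 'x) set set" where
  "cls \<phi> = {u \<in> PC_reps X \<H>. u \<subseteq> \<phi>}"

definition pieces :: "('x \<times> 'x) set set" where
  "pieces = {\<phi> \<in> self_homeos X. cls \<phi> \<noteq> {}}"

lemma piecesD: "\<phi> \<in> pieces \<Longrightarrow> \<phi> \<in> self_homeos X"
  by (simp add: pieces_def)

lemma cls_agree:
  assumes "\<phi> \<in> self_homeos X" "u \<in> cls \<phi>"
  shows "agree_cofinitely X \<phi> u"
  using assms self_homeosD(1) by (intro subset_imp_agree) (auto simp: cls_def PC_reps_def)

lemma cls_iff_agree: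
  assumes "\<phi> \<in> self_homeos X"
  shows "u \<in> cls \<phi> \<longleftrightarrow> u \<in> PC_reps X \<H> \<and> agree_cofinitely X \<phi> u"
proof
  assume "u \<in> PC_reps X \<H> \<and> agree_cofinitely X \<phi> u"
  then show "u \<in> cls \<phi>"
    using agree_imp_subset[OF assms, of u] SP_ph by (auto simp: cls_def PC_reps_def)
qed (use cls_agree assms in \<open>auto simp: cls_def\<close>)

text \<open>Agreement is transitive, so the equivalence class of any representative inside
  \<open>\<phi>\<close> consists of all representatives inside \<open>\<phi>\<close>.\<close>

lemma PC_rel_Image:
  assumes "\<phi> \<in> self_homeos X" "w \<in> cls \<phi>"
  shows "PC_rel X \<H> `` {w} = cls \<phi>"
proof -
  have "agree_cofinitely X w v \<longleftrightarrow> agree_cofinitely X \<phi> v" for v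
    using cls_agree[OF assms] agree_cofinitely_sym agree_cofinitely_trans by blast
  moreover have "w \<in> PC_reps X \<H>" using assms(2) by (simp add: cls_def)
  ultimately show ?thesis using cls_iff_agree[OF assms(1)] by (auto simp: PC_rel_def)
qed

lemma represents_imp_cls:
  assumes "g \<in> carrier (PC X \<H>)" "represents X g \<phi>"
  shows "g = cls \<phi>" "\<phi> \<in> pieces"
proof -
  obtain w where w: "w \<in> PC_reps X \<H>" "g = PC_rel X \<H> `` {w}"
    using assms(1) by (auto simp: PC_def elim: quotientE)
  obtain u where \<phi>: "\<phi> \<in> self_homeos X" and u: "u \<in> g" "agree_cofinitely X \<phi> u"
    using assms(2) unfolding represents_def by blast
  have "agree_cofinitely X w u" using u w by (auto simp: PC_rel_def)
  then have "agree_cofinitely X \<phi> w"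
    using u(2) agree_cofinitely_sym agree_cofinitely_trans by blast
  then have "w \<in> cls \<phi>" using w(1) cls_iff_agree[OF \<phi>] by blast
  then show "g = cls \<phi>" "\<phi> \<in> pieces" using PC_rel_Image \<phi> w(2) by (auto simp: pieces_def)
qed

lemma cls_represents:
  assumes "\<phi> \<in> pieces" shows "represents X (cls \<phi>) \<phi>"
proof -
  have \<phi>: "\<phi> \<in> self_homeos X" and "cls \<phi> \<noteq> {}" using assms by (auto simp: pieces_def)
  then show ?thesis using cls_agree[OF \<phi>] unfolding represents_def by blast
qed

lemma cls_in_PC:
  assumes "\<phi> \<in> pieces" shows "cls \<phi> \<in> carrier (PC X \<H>)"
proof -
  obtain w where w: "w \<in> cls \<phi>" using assms by (auto simp: pieces_def)
  then have "cls \<phi> = PC_rel X \<H> `` {w}" using PC_rel_Image assms piecesD by metis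
  moreover have "w \<in> PC_reps X \<H>" using w by (simp add: cls_def)
  ultimately show ?thesis by (auto simp: PC_def intro: quotientI)
qed

text \<open>Two self-homeomorphisms representing the same class agree cofinitely, hence contain each
  other. This justifies the definite description in \<open>PC0_act\<close>.\<close>

lemma cls_represents_unique:
  assumes "\<phi> \<in> pieces" "represents X (cls \<phi>) \<psi>" shows "\<psi> = \<phi>"
proof -
  obtain u where \<psi>: "\<psi> \<in> self_homeos X" and u: "u \<in> cls \<phi>" "agree_cofinitely X \<psi> u"
    using assms(2) unfolding represents_def by blast
  have \<phi>: "\<phi> \<in> self_homeos X" using assms(1) by (rule piecesD)
  have "agree_cofinitely X \<phi> \<psi>"
    using cls_agree[OF \<phi> u(1)] u(2) agree_cofinitely_sym agree_cofinitely_trans by blast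
  then show ?thesis
    using agree_imp_subset \<phi> \<psi> agree_cofinitely_sym self_homeosD(1) by (metis subset_antisym)
qed

lemma PC0_act_cls: "\<phi> \<in> pieces \<Longrightarrow> PC0_act X (cls \<phi>) = \<phi>"
  unfolding PC0_act_def using cls_represents cls_represents_unique by (rule the_equality)

lemma cls_inj: "\<phi> \<in> pieces \<Longrightarrow> \<psi> \<in> pieces \<Longrightarrow> cls \<phi> = cls \<psi> \<Longrightarrow> \<phi> = \<psi>"
  using PC0_act_cls by metis

lemma carrier_PC0: "carrier (PC0 X \<H>) = cls ` pieces"
proof
  show "carrier (PC0 X \<H>) \<subseteq> cls ` pieces"
    using represents_imp_cls by (fastforce simp: PC0_def)
  show "cls ` pieces \<subseteq> carrier (PC0 X \<H>)"
    using cls_represents cls_in_PC by (auto simp: PC0_def)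
qed

lemma PC_reps_relcomp:
  assumes "u \<in> PC_reps X \<H>" "v \<in> PC_reps X \<H>" shows "u O v \<in> PC_reps X \<H>"
proof -
  have "u \<in> SP" "v \<in> SP" using assms by (auto simp: PC_reps_def)
  then have ph: "u \<in> partial_homeos X X" "v \<in> partial_homeos X X" and "u O v \<in> SP"
    using SP_ph SP_relcomp by auto
  moreover have "cofinite_in X (Domain (u O v))"
    using assms ph by (intro cofinite_relcomp) (auto simp: PC_reps_def)
  moreover have "cofinite_in X (Domain (v\<inverse> O u\<inverse>))"
    using assms ph by (intro cofinite_relcomp partial_homeos_converse) (auto simp: PC_reps_def)
  then have "cofinite_in X (Range (u O v))"
    by (metis Domain_converse converse_relcomp)
  ultimately show ?thesis by (simp add: PC_reps_def)
qed

lemma cls_relcomp: "u \<in> cls \<phi> \<Longrightarrow> v \<in> cls \<psi> \<Longrightarrow> u O v \<in> cls (\<phi> O \<psi>)"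
  using PC_reps_relcomp relcomp_mono[of u \<phi> v \<psi>] by (auto simp: cls_def)

lemma pieces_relcomp: "\<phi> \<in> pieces \<Longrightarrow> \<psi> \<in> pieces \<Longrightarrow> \<phi> O \<psi> \<in> pieces"
  using cls_relcomp self_homeos_relcomp unfolding pieces_def by fastforce

lemma pieces_converse: "\<phi> \<in> pieces \<Longrightarrow> \<phi>\<inverse> \<in> pieces"
proof -
  assume \<phi>: "\<phi> \<in> pieces"
  then obtain u where "u \<in> PC_reps X \<H>" "u \<subseteq> \<phi>" by (auto simp: pieces_def cls_def)
  then have "u\<inverse> \<in> cls (\<phi>\<inverse>)" by (auto simp: cls_def PC_reps_def SP_converse)
  then show ?thesis using \<phi> by (auto simp: pieces_def self_homeos_converse)
qed

lemma Id_in_cls: "Id_on (topspace X) \<in> cls (Id_on (topspace X))"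
  by (auto simp: cls_def PC_reps_def SP_Id cofinite_in_def)

lemma pieces_Id: "Id_on (topspace X) \<in> pieces"
  using Id_in_cls self_homeos_Id_on by (auto simp: pieces_def)

text \<open>All choices of representatives yield the same class, so the double union collapses. The
  factors are swapped because \<open>O\<close> composes from left to right.\<close>

lemma PC_mult_cls:
  assumes "\<phi> \<in> pieces" "\<psi> \<in> pieces"
  shows "cls \<phi> \<otimes>\<^bsub>PC X \<H>\<^esub> cls \<psi> = cls (\<psi> O \<phi>)"
proof -
  have "PC_rel X \<H> `` {v O u} = cls (\<psi> O \<phi>)" if "u \<in> cls \<phi>" "v \<in> cls \<psi>" for u v
    using assms that by (intro PC_rel_Image cls_relcomp piecesD pieces_relcomp)
  moreover have "cls \<phi> \<noteq> {}" "cls \<psi> \<noteq> {}" using assms by (auto simp: pieces_def)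
  ultimately show ?thesis by (simp add: PC_def)
qed

lemma PC_one: "\<one>\<^bsub>PC X \<H>\<^esub> = cls (Id_on (topspace X))"
  using PC_rel_Image[OF self_homeos_Id_on Id_in_cls] by (simp add: PC_def)

lemma PC0_mult [simp]: "mult (PC0 X \<H>) = mult (PC X \<H>)"
  and PC0_one [simp]: "one (PC0 X \<H>) = one (PC X \<H>)"
  by (simp_all add: PC0_def)

text \<open>The group laws are transferred along \<open>cls\<close> from the self-homeomorphisms in
  \<open>pieces\<close>.\<close>

lemma group_PC0: "group (PC0 X \<H>)"
proof (rule groupI)
  fix x y z assume "x \<in> carrier (PC0 X \<H>)" "y \<in> carrier (PC0 X \<H>)" "z \<in> carrier (PC0 X \<H>)"
  then show "x \<otimes>\<^bsub>PC0 X \<H>\<^esub> y \<otimes>\<^bsub>PC0 X \<H>\<^esub> z = x \<otimes>\<^bsub>PC0 X \<H>\<^esub> (y \<otimes>\<^bsub>PC0 X \<H>\<^esub> z)"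
    by (auto simp: carrier_PC0 PC_mult_cls pieces_relcomp O_assoc)
next
  fix x assume "x \<in> carrier (PC0 X \<H>)"
  then obtain \<phi> where \<phi>: "x = cls \<phi>" "\<phi> \<in> pieces" by (auto simp: carrier_PC0)
  have "\<phi> O Id_on (topspace X) = \<phi>"
    using partial_homeos_subset[OF self_homeosD(1)[OF piecesD[OF \<phi>(2)]]] by auto
  then show "\<one>\<^bsub>PC0 X \<H>\<^esub> \<otimes>\<^bsub>PC0 X \<H>\<^esub> x = x"
    using \<phi> by (simp add: PC_one PC_mult_cls pieces_Id)
  have "cls (\<phi>\<inverse>) \<otimes>\<^bsub>PC0 X \<H>\<^esub> x = \<one>\<^bsub>PC0 X \<H>\<^esub>"
    using \<phi> by (simp add: PC_one PC_mult_cls pieces_converse self_homeosD(2)[OF piecesD])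
  then show "\<exists>y\<in>carrier (PC0 X \<H>). y \<otimes>\<^bsub>PC0 X \<H>\<^esub> x = \<one>\<^bsub>PC0 X \<H>\<^esub>"
    using \<phi> pieces_converse by (auto simp: carrier_PC0)
qed (auto simp: carrier_PC0 PC_mult_cls PC_one pieces_relcomp pieces_Id)

lemma inv_PC0_cls:
  assumes "\<phi> \<in> pieces" shows "inv\<^bsub>PC0 X \<H>\<^esub> (cls \<phi>) = cls (\<phi>\<inverse>)"
proof (rule group.inv_equality[OF group_PC0])
  show "cls (\<phi>\<inverse>) \<otimes>\<^bsub>PC0 X \<H>\<^esub> cls \<phi> = \<one>\<^bsub>PC0 X \<H>\<^esub>"
    using assms by (simp add: PC_one PC_mult_cls pieces_converse self_homeosD(2)[OF piecesD])
qed (use assms pieces_converse in \<open>auto simp: carrier_PC0\<close>)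

text \<open>\<open>reg \<phi>\<close> contains every representative inside \<open>\<phi>\<close>,
  hence has cofinite domain and range. It is therefore the largest element of its class.\<close>

lemma reg_in_cls:
  assumes "\<phi> \<in> pieces" shows "reg \<phi> \<in> cls \<phi>"
proof -
  have ph: "\<phi> \<in> partial_homeos X X" using assms by (intro self_homeosD piecesD)
  have SP: "reg \<phi> \<in> SP"
    unfolding reg_def using ph by (intro SP_Union_subset[of _ \<phi>]) auto
  obtain u where u: "u \<in> PC_reps X \<H>" "u \<subseteq> \<phi>" using assms by (auto simp: pieces_def cls_def)
  then have "u \<subseteq> reg \<phi>" by (auto simp: PC_reps_def intro: regI)
  then have "Domain u \<subseteq> Domain (reg \<phi>)" "Range u \<subseteq> Range (reg \<phi>)" by auto
  moreover have "Domain (reg \<phi>) \<subseteq> topspace X" "Range (reg \<phi>) \<subseteq> topspace X"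
    using partial_homeos_subset[OF SP_ph[OF SP]] by auto
  ultimately have "cofinite_in X (Domain (reg \<phi>))" "cofinite_in X (Range (reg \<phi>))"
    using u(1) cofinite_mono by (auto simp: PC_reps_def)
  then show ?thesis using SP reg_subset by (simp add: cls_def PC_reps_def)
qed

lemma alpha_cls: "\<phi> \<in> pieces \<Longrightarrow> alpha_S (cls \<phi>) = reg \<phi>"
proof
  show "alpha_S (cls \<phi>) \<subseteq> reg \<phi>" by (auto simp: alpha_S_def cls_def PC_reps_def intro: regI)
qed (use reg_in_cls in \<open>auto simp: alpha_S_def\<close>)

end

section \<open>Transfixing\<close>

lemma relcomp_cancel:
  assumes "\<phi> \<in> self_homeos X"
  shows "\<phi>\<inverse> O (\<phi> O g) \<subseteq> g"
  using self_homeosD(3)[OF assms] by (auto simp flip: O_assoc)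

lemma relcomp_cancel_eq:
  assumes "\<phi> \<in> self_homeos X" "Domain g \<subseteq> topspace X"
  shows "\<phi>\<inverse> O (\<phi> O g) = g"
proof -
  have "Id_on (topspace X) O g = g" using assms(2) by auto
  then show ?thesis using self_homeosD(3)[OF assms(1)] by (simp flip: O_assoc)
qed

text \<open>\<open>\<Phi>\<close> stands for the group of self-homeomorphisms given by \<open>H\<close>, and \<open>E\<close> for the set of
  points whose class lies in the invariant subset \<open>X0\<close> of the globalization; thus \<open>X0\<close> consists of
  the classes of \<open>(\<phi>, x)\<close> with \<open>\<phi> \<in> \<Phi>\<close> and \<open>x \<in> E\<close>. The map \<open>[(\<phi>, x)] \<mapsto> \<phi> x\<close>
  from the globalization to \<open>X\<close> sends the classes of \<open>X0\<close> outside \<open>X\<close> into \<open>N\<close>.\<close>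

locale transfixing = S_modeled A S X \<H>
  for A :: "'a topology" and S and X :: "'x topology" and \<H> +
  fixes \<Phi> :: "('x \<times> 'x) set set" and E :: "'x set" and N :: "'x set"
  defines "N \<equiv> {y. \<exists>\<phi>\<in>\<Phi>. \<exists>x\<in>E. (x, y) \<in> \<phi> - reg \<phi>}"
  assumes \<Phi>_pieces: "\<Phi> \<subseteq> pieces"
    and \<Phi>_Id: "Id_on (topspace X) \<in> \<Phi>"
    and \<Phi>_converse: "\<phi> \<in> \<Phi> \<Longrightarrow> \<phi>\<inverse> \<in> \<Phi>"
    and \<Phi>_relcomp: "\<phi> \<in> \<Phi> \<Longrightarrow> \<psi> \<in> \<Phi> \<Longrightarrow> \<phi> O \<psi> \<in> \<Phi>"
    and E_cofinite: "cofinite_in X E"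
    and N_finite: "finite N"
begin

lemma \<Phi>_self: "\<phi> \<in> \<Phi> \<Longrightarrow> \<phi> \<in> self_homeos X"
  using \<Phi>_pieces piecesD by blast

lemma \<Phi>_ph: "\<phi> \<in> \<Phi> \<Longrightarrow> \<phi> \<in> partial_homeos X X"
  using \<Phi>_self self_homeosD(1) by blast

text \<open>Over a point \<open>y\<close> of this set the only class of \<open>X0\<close> is
  \<open>y\<close> itself: \<open>y \<in> E\<close> puts the embedded point in \<open>X0\<close>,
  and \<open>y \<notin> N\<close> makes every other pair over \<open>y\<close> equivalent to
  it.\<close>

definition Y :: "'x set" where
  "Y = E - N"

text \<open>The points with exactly one preimage in \<open>X0\<close>.\<close>

definition Y' :: "'x set" where
  "Y' = {y \<in> topspace X. (\<exists>\<phi>\<in>\<Phi>. \<exists>x\<in>E. (x, y) \<in> \<phi>) \<and>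
     (\<forall>\<phi>\<in>\<Phi>. \<forall>\<psi>\<in>\<Phi>. \<forall>x\<in>E. \<forall>x'\<in>E. (x, y) \<in> \<phi> \<longrightarrow> (x', y) \<in> \<psi> \<longrightarrow> (x, x') \<in> reg (\<phi> O \<psi>\<inverse>))}"

text \<open>The conclusion says that \<open>(\<phi>, x)\<close> and \<open>(\<psi>, x')\<close> are
  the same point of the globalization.\<close>

lemma Y'D:
  assumes "y \<in> Y'" "\<phi> \<in> \<Phi>" "x \<in> E" "(x, y) \<in> \<phi>" "\<psi> \<in> \<Phi>" "x' \<in> E" "(x', y) \<in> \<psi>"
  shows "(x, x') \<in> reg (\<phi> O \<psi>\<inverse>)"
  using assms unfolding Y'_def by blast

lemma Y'_topspace: "Y' \<subseteq> topspace X"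
  by (auto simp: Y'_def)

lemma Y_reg: "y \<in> Y \<Longrightarrow> \<phi> \<in> \<Phi> \<Longrightarrow> x \<in> E \<Longrightarrow> (x, y) \<in> \<phi> \<Longrightarrow> (x, y) \<in> reg \<phi>"
  unfolding Y_def N_def by blast

lemma Y_cofinite: "cofinite_in X Y"
proof -
  have "topspace X - Y \<subseteq> (topspace X - E) \<union> N" by (auto simp: Y_def)
  moreover have "finite ((topspace X - E) \<union> N)"
    using E_cofinite N_finite by (simp add: cofinite_in_def)
  ultimately have "finite (topspace X - Y)" by (rule finite_subset)
  then show ?thesis using E_cofinite by (auto simp: cofinite_in_def Y_def)
qed

text \<open>Any two pairs over \<open>y \<in> Y\<close> are both equivalent to the embedded point
  \<open>y\<close>, hence to each other.\<close>

lemma Y_subset_Y': "Y \<subseteq> Y'"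
proof
  fix y assume y: "y \<in> Y"
  then have yE: "y \<in> E" "y \<in> topspace X" using E_cofinite by (auto simp: Y_def cofinite_in_def)
  have "\<exists>\<phi>\<in>\<Phi>. \<exists>x\<in>E. (x, y) \<in> \<phi>" using yE \<Phi>_Id by blast
  moreover have "(x, x') \<in> reg (\<phi> O \<psi>\<inverse>)"
    if "\<phi> \<in> \<Phi>" "\<psi> \<in> \<Phi>" "x \<in> E" "x' \<in> E" "(x, y) \<in> \<phi>" "(x', y) \<in> \<psi>" for \<phi> \<psi> x x'
    using that y by (meson Y_reg reg_converse reg_relcomp)
  ultimately show "y \<in> Y'" using yE unfolding Y'_def by blast
qed

lemma Y'_cofinite: "cofinite_in X Y'"
  using Y_cofinite Y_subset_Y' Y'_topspace by (rule cofinite_mono)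

lemma Y'_openin: "openin X Y'"
  using Hausdorff Y'_cofinite by (rule cofinite_openin)

text \<open>Pairs \<open>(\<phi>, x)\<close> over \<open>z\<close> correspond to pairs
  \<open>(\<phi> O \<theta>\<inverse>, x)\<close> over \<open>y\<close>, and \<open>\<theta>\<close>
  cancels in the map comparing two of them.\<close>

lemma Y'_step:
  assumes \<theta>: "\<theta> \<in> \<Phi>" and y: "y \<in> Y'" and yz: "(y, z) \<in> \<theta>"
  shows "z \<in> Y'"
proof -
  have z: "z \<in> topspace X" using partial_homeos_topspace[OF \<Phi>_ph[OF \<theta>] yz] by simp
  obtain \<phi> x where "\<phi> \<in> \<Phi>" "x \<in> E" "(x, y) \<in> \<phi>" using y unfolding Y'_def by blast
  then have "\<phi> O \<theta> \<in> \<Phi>" "x \<in> E" "(x, z) \<in> \<phi> O \<theta>" using \<theta> yz \<Phi>_relcomp by auto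
  then have "\<exists>\<phi>\<in>\<Phi>. \<exists>x\<in>E. (x, z) \<in> \<phi>" by blast
  moreover have "(x, x') \<in> reg (\<phi> O \<psi>\<inverse>)"
    if "\<phi> \<in> \<Phi>" "\<psi> \<in> \<Phi>" "x \<in> E" "x' \<in> E" "(x, z) \<in> \<phi>" "(x', z) \<in> \<psi>" for \<phi> \<psi> x x'
  proof -
    have "\<phi> O \<theta>\<inverse> \<in> \<Phi>" "\<psi> O \<theta>\<inverse> \<in> \<Phi>" using that \<theta> \<Phi>_relcomp \<Phi>_converse by auto
    moreover have "(x, y) \<in> \<phi> O \<theta>\<inverse>" "(x', y) \<in> \<psi> O \<theta>\<inverse>" using that yz by auto
    ultimately have "(x, x') \<in> reg ((\<phi> O \<theta>\<inverse>) O (\<psi> O \<theta>\<inverse>)\<inverse>)"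
      using y that(3,4) by (intro Y'D)
    also have "(\<phi> O \<theta>\<inverse>) O (\<psi> O \<theta>\<inverse>)\<inverse> = \<phi> O (\<theta>\<inverse> O (\<theta> O \<psi>\<inverse>))"
      by (simp add: O_assoc converse_relcomp)
    also have "\<theta>\<inverse> O (\<theta> O \<psi>\<inverse>) = \<psi>\<inverse>"
      using partial_homeos_subset[OF \<Phi>_ph[OF that(2)]]
      by (intro relcomp_cancel_eq[OF \<Phi>_self[OF \<theta>]]) auto
    finally show ?thesis .
  qed
  ultimately show ?thesis using z unfolding Y'_def by blast
qed

lemma Y'_Image: "\<theta> \<in> \<Phi> \<Longrightarrow> \<theta> `` Y' = Y'"
proof
  assume \<theta>: "\<theta> \<in> \<Phi>"
  show "\<theta> `` Y' \<subseteq> Y'" using Y'_step[OF \<theta>] by blast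
  show "Y' \<subseteq> \<theta> `` Y'"
  proof
    fix z assume z: "z \<in> Y'"
    then obtain y where y: "(y, z) \<in> \<theta>" using self_homeosD(5)[OF \<Phi>_self[OF \<theta>]] Y'_topspace by blast
    then have "y \<in> Y'" using Y'_step[OF \<Phi>_converse[OF \<theta>] z] by simp
    then show "z \<in> \<theta> `` Y'" using y by blast
  qed
qed

text \<open>The transported structure: at \<open>y \<in> Y'\<close> with preimage \<open>[(\<phi>, x)]\<close> in \<open>X0\<close>, the germs of the
  charts are those of \<open>f \<circ> \<phi>\<inverse>\<close> for charts \<open>f\<close> at \<open>x\<close>.\<close>

definition charts_over :: "('x \<times> 'a) set \<Rightarrow> ('x \<times> 'x) set \<Rightarrow> 'x \<Rightarrow> 'a \<Rightarrow> bool" where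
  "charts_over g \<phi> x a \<longleftrightarrow> (\<exists>f\<in>\<H>. (x, a) \<in> f \<and> f \<subseteq> \<phi> O g)"

text \<open>Ranging over all pairs above \<open>y\<close> avoids choosing a representative; on
  \<open>Y'\<close> one pair suffices by \<open>charts_over_transfer\<close>.\<close>

definition K :: "('x \<times> 'a) set set" where
  "K = {g \<in> partial_homeos X A. Domain g \<subseteq> Y' \<and>
     (\<forall>y a. (y, a) \<in> g \<longrightarrow> (\<forall>\<phi>\<in>\<Phi>. \<forall>x\<in>E. (x, y) \<in> \<phi> \<longrightarrow> charts_over g \<phi> x a))}"

lemma KI:
  assumes "g \<in> partial_homeos X A" "Domain g \<subseteq> Y'"
    and "\<And>y a \<phi> x. (y, a) \<in> g \<Longrightarrow> \<phi> \<in> \<Phi> \<Longrightarrow> x \<in> E \<Longrightarrow> (x, y) \<in> \<phi> \<Longrightarrow> charts_over g \<phi> x a"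
  shows "g \<in> K"
  using assms unfolding K_def by blast

lemma K_ph: "g \<in> K \<Longrightarrow> g \<in> partial_homeos X A"
  and K_Domain: "g \<in> K \<Longrightarrow> Domain g \<subseteq> Y'"
  by (simp_all add: K_def)

lemma KD:
  "g \<in> K \<Longrightarrow> (y, a) \<in> g \<Longrightarrow> \<phi> \<in> \<Phi> \<Longrightarrow> x \<in> E \<Longrightarrow> (x, y) \<in> \<phi> \<Longrightarrow> charts_over g \<phi> x a"
  unfolding K_def by blast

lemma charts_over_mono: "charts_over g \<phi> x a \<Longrightarrow> g \<subseteq> g' \<Longrightarrow> charts_over g' \<phi> x a"
  unfolding charts_over_def by (meson order_refl relcomp_mono subset_trans)

text \<open>The germ condition is independent of the pair chosen over \<open>y\<close>: two pairs
  differ by a map that is regular at the point in question, along which charts pull back.\<close>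

lemma charts_over_transfer:
  assumes y: "y \<in> Y'" and 1: "\<phi> \<in> \<Phi>" "x \<in> E" "(x, y) \<in> \<phi>" "charts_over g \<phi> x a"
    and 2: "\<psi> \<in> \<Phi>" "x' \<in> E" "(x', y) \<in> \<psi>"
  shows "charts_over g \<psi> x' a"
proof -
  obtain f where f: "f \<in> \<H>" "(x, a) \<in> f" "f \<subseteq> \<phi> O g" using 1(4) unfolding charts_over_def by blast
  have "(x', x) \<in> reg (\<psi> O \<phi>\<inverse>)" using y 2 1(1-3) by (rule Y'D)
  from chart_pull[OF this f(1,2)]
  obtain f' where f': "f' \<in> \<H>" "(x', a) \<in> f'" "f' \<subseteq> (\<psi> O \<phi>\<inverse>) O f" by blast
  have "(\<psi> O \<phi>\<inverse>) O f \<subseteq> \<psi> O (\<phi>\<inverse> O (\<phi> O g))"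
    unfolding O_assoc using f(3) by (intro relcomp_mono) auto
  also have "\<dots> \<subseteq> \<psi> O g" 

    by (intro relcomp_mono order_refl relcomp_cancel[OF \<Phi>_self[OF 1(1)]])
  finally have "f' \<subseteq> \<psi> O g" using f'(3) by (rule order_trans[rotated])
  then show ?thesis using f' unfolding charts_over_def by blast
qed

lemma E_over:
  assumes "y \<in> Y'" obtains \<phi> x where "\<phi> \<in> \<Phi>" "x \<in> E" "(x, y) \<in> \<phi>"
  using assms unfolding Y'_def by blast

text \<open>Near \<open>x\<close>, all points other than \<open>x\<close> itself are regular for \<open>\<phi>\<close> and mapped into \<open>Y\<close>,
  as these conditions exclude only finitely many points.\<close>

lemma K_covers:
  assumes y: "y \<in> Y'" shows "\<exists>g\<in>K. \<exists>a. (y, a) \<in> g"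
proof -
  obtain \<phi> x where \<phi>: "\<phi> \<in> \<Phi>" and x: "x \<in> E" "(x, y) \<in> \<phi>" using y by (rule E_over)
  have ph: "\<phi> \<in> partial_homeos X X" using \<phi> by (rule \<Phi>_ph)
  have xX: "x \<in> topspace X" using partial_homeos_topspace[OF ph x(2)] by simp
  then obtain f0 a where f0: "f0 \<in> \<H>" "(x, a) \<in> f0" using chart_at by blast
  define W0 where "W0 = Domain (reg \<phi>) \<inter> \<phi>\<inverse> `` Y"
  \<comment> \<open>The point \<open>x\<close> is put back even if \<open>\<phi>\<close> is not
    regular there; the set stays cofinite, hence open.\<close>
  define W where "W = insert x W0"
  have "cofinite_in X (\<phi>\<inverse> `` Y)"
  proof -
    have "topspace X - \<phi>\<inverse> `` Y \<subseteq> \<phi>\<inverse> `` (topspace X - Y)"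
    proof
      fix z assume z: "z \<in> topspace X - \<phi>\<inverse> `` Y"
      then obtain w where w: "(z, w) \<in> \<phi>" using self_homeosD(4)[OF \<Phi>_self[OF \<phi>]] by blast
      then have "w \<in> topspace X" using partial_homeos_topspace[OF ph] by blast
      then show "z \<in> \<phi>\<inverse> `` (topspace X - Y)" using z w by blast
    qed
    moreover have "finite (\<phi>\<inverse> `` (topspace X - Y))"
      using ph Y_cofinite
      by (intro finite_Image_single_valued) (auto simp: partial_homeos_iff cofinite_in_def)
    ultimately have "finite (topspace X - \<phi>\<inverse> `` Y)" by (rule finite_subset)
    moreover have "\<phi>\<inverse> `` Y \<subseteq> topspace X" using partial_homeos_subset[OF ph] by blast
    ultimately show ?thesis by (simp add: cofinite_in_def)
  qed
  moreover have "cofinite_in X (Domain (reg \<phi>))"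
    using reg_in_cls \<Phi>_pieces \<phi> by (auto simp: cls_def PC_reps_def)
  ultimately have W0: "cofinite_in X W0" unfolding W0_def by (intro cofinite_Int)
  then have "cofinite_in X W"
    using xX by (intro cofinite_mono[OF W0]) (auto simp: W_def cofinite_in_def)
  then have W: "openin X W" by (rule cofinite_openin[OF Hausdorff])
  define f where "f = Id_on W O f0"
  have f_ph: "f \<in> partial_homeos X A"
    unfolding f_def 
    by (rule partial_homeos_relcomp[OF partial_homeos_Id_on[OF W] chart_ph[OF f0(1)]])
  then have f: "f \<in> \<H>" by (rule chart_restrict[OF f0(1), rotated]) (auto simp: f_def)
  have xa: "(x, a) \<in> f" using f0 by (auto simp: f_def W_def)
  have f_W: "x' = x \<or> x' \<in> W0" if "(x', b) \<in> f" for x' b using that by (auto simp: f_def W_def)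
  have f_Domain: "Domain f \<subseteq> topspace X" using partial_homeos_subset[OF f_ph] by blast
  define g where "g = \<phi>\<inverse> O f"
  have f_sub: "f \<subseteq> \<phi> O g"
    using relcomp_cancel_eq[OF self_homeos_converse[OF \<Phi>_self[OF \<phi>]] f_Domain] by (simp add: g_def)
  \<comment> \<open>Every point of \<open>g\<close> other than the one over \<open>y\<close> comes
    from a regular point of \<open>\<phi>\<close> and lies over \<open>Y\<close>.\<close>
  have g_case: "(y' = y \<and> b = a) \<or> (\<exists>x'. (x', y') \<in> reg \<phi> \<and> (x', b) \<in> f \<and> y' \<in> Y)"
    if "(y', b) \<in> g" for y' b
  proof -
    obtain x' where x': "(x', y') \<in> \<phi>" "(x', b) \<in> f" using \<open>(y', b) \<in> g\<close> unfolding g_def by blast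
    show ?thesis
    proof (cases "x' = x")
      case True
      then show ?thesis using x' x(2) xa partial_homeos_sv[OF ph] partial_homeos_sv[OF f_ph] by blast
    next
      case False
      then have "x' \<in> W0" using f_W x'(2) by blast
      then obtain z z' where z: "(x', z) \<in> reg \<phi>" "(x', z') \<in> \<phi>" "z' \<in> Y" unfolding W0_def by blast
      then have "z = y'" "z' = y'" using x'(1) reg_subset partial_homeos_sv[OF ph] by blast+
      then show ?thesis using z x'(2) by blast
    qed
  qed
  have "g \<in> K"
  proof (rule KI)
    show "g \<in> partial_homeos X A"
      unfolding g_def using ph f_ph by (intro partial_homeos_relcomp partial_homeos_converse)
    show "Domain g \<subseteq> Y'" using g_case y Y_subset_Y' by blast
    fix y' b \<psi> x1 assume g: "(y', b) \<in> g" and \<psi>: "\<psi> \<in> \<Phi>" "x1 \<in> E" "(x1, y') \<in> \<psi>"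
    from g_case[OF g] show "charts_over g \<psi> x1 b"
    proof (elim disjE exE conjE)
      \<comment> \<open>At \<open>y\<close> the chart \<open>f\<close> itself witnesses the
        condition for the pair \<open>(\<phi>, x)\<close>, regular or not.\<close>
      assume *: "y' = y" "b = a"
      have "charts_over g \<phi> x a" using f xa f_sub unfolding charts_over_def by blast
      then show ?thesis using charts_over_transfer[OF y \<phi> x] \<psi> * by blast
    next
      \<comment> \<open>Elsewhere \<open>\<phi>\<close> is regular, so \<open>g\<close> contains an
        original chart at \<open>y'\<close>. The identity with \<open>y' \<in> E\<close> is then a
        suitable pair.\<close>
      fix x' assume x': "(x', y') \<in> reg \<phi>" "(x', b) \<in> f" and y': "y' \<in> Y"
      from chart_pull[OF reg_converse[OF x'(1)] f x'(2)]
      obtain f' where f': "f' \<in> \<H>" "(y', b) \<in> f'" "f' \<subseteq> g" unfolding g_def by blast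
      have yE: "y' \<in> E" "(y', y') \<in> Id_on (topspace X)"
        using y' E_cofinite by (auto simp: Y_def cofinite_in_def)
      have "Domain f' \<subseteq> topspace X" using partial_homeos_subset[OF chart_ph[OF f'(1)]] by blast
      then have "f' \<subseteq> Id_on (topspace X) O g" using f'(3) by auto
      then have "charts_over g (Id_on (topspace X)) y' b"
        using f' unfolding charts_over_def by blast
      then show ?thesis
        using charts_over_transfer[OF _ \<Phi>_Id yE] y' Y_subset_Y' \<psi> by blast
    qed
  qed
  moreover have "(y, a) \<in> g" using x(2) xa unfolding g_def by blast
  ultimately show ?thesis by blast
qed

text \<open>Lift both charts through the same pair \<open>(\<phi>, x)\<close>: the two copies of
  \<open>\<phi>\<close> cancel, leaving a transition map of the original structure inside
  \<open>g1\<inverse> O g2\<close>.\<close>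

lemma K_transition:
  assumes g1: "g1 \<in> K" and g2: "g2 \<in> K" shows "g1\<inverse> O g2 \<in> pseudogroup_hat A S"
proof (rule hatI)
  show "g1\<inverse> O g2 \<in> partial_homeos A A"
    using g1 g2 K_ph by (intro partial_homeos_relcomp partial_homeos_converse)
  fix a b assume "(a, b) \<in> g1\<inverse> O g2"
  then obtain y where y: "(y, a) \<in> g1" "(y, b) \<in> g2" by blast
  then have "y \<in> Y'" using K_Domain[OF g1] by blast
  then obtain \<phi> x where \<phi>: "\<phi> \<in> \<Phi>" "x \<in> E" "(x, y) \<in> \<phi>" by (rule E_over)
  obtain f1 f2 where f: "f1 \<in> \<H>" "(x, a) \<in> f1" "f1 \<subseteq> \<phi> O g1" "f2 \<in> \<H>" "(x, b) \<in> f2" "f2 \<subseteq> \<phi> O g2"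
    using KD[OF g1 y(1) \<phi>] KD[OF g2 y(2) \<phi>] unfolding charts_over_def by blast
  have "f1\<inverse> \<subseteq> (\<phi> O g1)\<inverse>" using f(3) by blast
  then have "f1\<inverse> O f2 \<subseteq> (\<phi> O g1)\<inverse> O (\<phi> O g2)" using f(6) by (rule relcomp_mono)
  also have "\<dots> = g1\<inverse> O (\<phi>\<inverse> O (\<phi> O g2))" by (simp add: converse_relcomp O_assoc)
  also have "\<dots> \<subseteq> g1\<inverse> O g2" 

    by (intro relcomp_mono order_refl relcomp_cancel[OF \<Phi>_self[OF \<phi>(1)]])
  finally have "f1\<inverse> O f2 \<subseteq> g1\<inverse> O g2" .
  moreover have "(a, b) \<in> f1\<inverse> O f2" using f by blast
  moreover have "f1\<inverse> O f2 \<in> pseudogroup_hat A S" using f by (intro transition)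
  ultimately show "\<exists>v\<in>pseudogroup_hat A S. (a, b) \<in> v \<and> v \<subseteq> g1\<inverse> O g2" by metis
qed

lemma K_structure: "S_structure A S (subtopology X Y') K"
proof -
  have ph: "partial_homeos (subtopology X Y') A = {u \<in> partial_homeos X A. Domain u \<subseteq> Y'}"
    using Y'_openin by (rule partial_homeos_subtopology)
  have "(\<Union>f\<in>K. Domain f) = Y'"
  proof
    show "(\<Union>f\<in>K. Domain f) \<subseteq> Y'" using K_Domain by (rule UN_least)
    show "Y' \<subseteq> (\<Union>f\<in>K. Domain f)"
    proof
      fix y assume "y \<in> Y'"
      then obtain g a where "g \<in> K" "(y, a) \<in> g" using K_covers by metis
      then show "y \<in> (\<Union>f\<in>K. Domain f)" by (intro UN_I[of g] DomainI)
    qed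
  qed
  moreover have "{} \<in> K" by (rule KI) (auto simp: partial_homeos_empty)
  ultimately have "S_atlas A S (subtopology X Y') K"
    using K_transition K_ph K_Domain Y'_topspace unfolding S_atlas_def ph by auto
  moreover have "g O u \<in> K" if g: "g \<in> K" and u: "u \<in> S" for g u
  proof (rule KI)
    show "g O u \<in> partial_homeos X A"
      using g u pseudogroup K_ph by (intro partial_homeos_relcomp) (auto simp: pseudogroup_def)
    show "Domain (g O u) \<subseteq> Y'" using K_Domain[OF g] by blast
    fix y b \<phi> x assume "(y, b) \<in> g O u" and \<phi>: "\<phi> \<in> \<Phi>" "x \<in> E" "(x, y) \<in> \<phi>"
    then obtain a where a: "(y, a) \<in> g" "(a, b) \<in> u" by blast
    then obtain f where f: "f \<in> \<H>" "(x, a) \<in> f" "f \<subseteq> \<phi> O g"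
      using KD[OF g _ \<phi>] unfolding charts_over_def by blast
    have "f O u \<in> \<H>" using struct f(1) u unfolding S_structure_def complete_atlas_def by blast
    moreover have "(x, b) \<in> f O u" using f(2) a(2) by (rule relcompI)
    moreover have "f O u \<subseteq> \<phi> O (g O u)"
      using relcomp_mono[OF f(3) order_refl, of u] by (simp add: O_assoc)
    ultimately show "charts_over (g O u) \<phi> x b" unfolding charts_over_def by metis
  qed
  moreover have "\<Union>C \<in> K" if C: "C \<subseteq> K" "\<Union>C \<in> partial_homeos (subtopology X Y') A" for C
  proof (rule KI)
    show "\<Union>C \<in> partial_homeos X A" "Domain (\<Union>C) \<subseteq> Y'" using C(2) unfolding ph by auto
    fix y a \<phi> x assume "(y, a) \<in> \<Union>C" and \<phi>: "\<phi> \<in> \<Phi>" "x \<in> E" "(x, y) \<in> \<phi>"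
    then obtain g where g: "g \<in> C" "(y, a) \<in> g" by blast
    then have "charts_over g \<phi> x a" using KD[OF _ g(2) \<phi>] C(1) by blast
    then show "charts_over (\<Union>C) \<phi> x a" by (rule charts_over_mono) (use g in blast)
  qed
  ultimately show ?thesis unfolding S_structure_def complete_atlas_def by blast
qed

text \<open>Replacing \<open>(\<phi>, x)\<close> over \<open>z\<close> by
  \<open>(\<phi> O \<theta>\<inverse>, x)\<close> over \<open>y\<close> leaves the germ condition
  unchanged, by associativity.\<close>

lemma K_transport:
  assumes \<theta>: "\<theta> \<in> \<Phi>" and g: "g \<in> K"
  shows "\<theta>\<inverse> O g \<in> K"
proof (rule KI)
  show "\<theta>\<inverse> O g \<in> partial_homeos X A"
    using \<theta> g \<Phi>_ph K_ph by (intro partial_homeos_relcomp partial_homeos_converse)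
  show "Domain (\<theta>\<inverse> O g) \<subseteq> Y'" using K_Domain[OF g] Y'_step[OF \<theta>] by blast
  fix z a \<phi> x assume "(z, a) \<in> \<theta>\<inverse> O g" and \<phi>: "\<phi> \<in> \<Phi>" "x \<in> E" "(x, z) \<in> \<phi>"
  then obtain y where y: "(y, z) \<in> \<theta>" "(y, a) \<in> g" by blast
  have "\<phi> O \<theta>\<inverse> \<in> \<Phi>" "(x, y) \<in> \<phi> O \<theta>\<inverse>" using \<theta> \<phi> y \<Phi>_relcomp \<Phi>_converse by auto
  then have "charts_over g (\<phi> O \<theta>\<inverse>) x a" using KD[OF g y(2)] \<phi>(2) by blast
  then show "charts_over (\<theta>\<inverse> O g) \<phi> x a" unfolding charts_over_def O_assoc .
qed

lemma K_invariant:
  assumes \<theta>: "\<theta> \<in> \<Phi>" shows "(\<lambda>f. \<theta>\<inverse> O f) ` K = K"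
proof
  show "(\<lambda>f. \<theta>\<inverse> O f) ` K \<subseteq> K" using K_transport[OF \<theta>] by blast
  show "K \<subseteq> (\<lambda>f. \<theta>\<inverse> O f) ` K"
  proof
    fix g assume g: "g \<in> K"
    have "\<theta> O g \<in> K" using K_transport[OF \<Phi>_converse[OF \<theta>] g] by simp
    moreover have "Domain g \<subseteq> topspace X" using K_Domain[OF g] Y'_topspace by (rule order_trans)
    then have "g = \<theta>\<inverse> O (\<theta> O g)" by (rule relcomp_cancel_eq[OF \<Phi>_self[OF \<theta>], symmetric])
    ultimately show "g \<in> (\<lambda>f. \<theta>\<inverse> O f) ` K" by (rule rev_image_eqI)
  qed
qed

text \<open>From \<open>K\<close> to the original structure, use the identity as the pair over
  \<open>y\<close>. Conversely, every pair over a point of \<open>Y\<close> is regular, so original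
  charts pull back along it.\<close>

lemma K_on_Y: "structure_on K Y = structure_on \<H> Y"
proof -
  have "g \<in> \<H>" if g: "g \<in> K" "Domain g \<subseteq> Y" for g
  proof (rule chartI[OF K_ph[OF g(1)]])
    fix y a assume ya: "(y, a) \<in> g"
    then have "y \<in> E" "(y, y) \<in> Id_on (topspace X)"
      using g(2) E_cofinite by (auto simp: Y_def cofinite_in_def)
    from KD[OF g(1) ya \<Phi>_Id this]
    obtain f where f: "f \<in> \<H>" "(y, a) \<in> f" "f \<subseteq> Id_on (topspace X) O g"
      unfolding charts_over_def by blast
    then have "f \<subseteq> g" by blast
    then show "\<exists>f\<in>\<H>. (y, a) \<in> f \<and> f \<subseteq> g" using f by blast
  qed
  moreover have "g \<in> K" if g: "g \<in> \<H>" "Domain g \<subseteq> Y" for g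
  proof (rule KI)
    show "g \<in> partial_homeos X A" using g(1) by (rule chart_ph)
    show "Domain g \<subseteq> Y'" using g(2) Y_subset_Y' by blast
    fix y a \<phi> x assume ya: "(y, a) \<in> g" and \<phi>: "\<phi> \<in> \<Phi>" "x \<in> E" "(x, y) \<in> \<phi>"
    have "(x, y) \<in> reg \<phi>" using Y_reg \<phi> ya g(2) by blast
    then show "charts_over g \<phi> x a" using chart_pull g(1) ya unfolding charts_over_def by blast
  qed
  ultimately show ?thesis unfolding structure_on_def by blast
qed

text \<open>The complement of \<open>Y'\<close> is finite and invariant, so it contains the whole
  orbit.\<close>

lemma finite_orbit:
  assumes "y \<in> topspace X - Y'" shows "finite (\<Union>\<phi>\<in>\<Phi>. \<phi> `` {y})"
proof (rule finite_subset)
  show "(\<Union>\<phi>\<in>\<Phi>. \<phi> `` {y}) \<subseteq> topspace X - Y'"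
  proof (intro subsetI DiffI; elim UN_E ImageE)
    fix z \<phi> w assume \<phi>: "\<phi> \<in> \<Phi>" "(w, z) \<in> \<phi>" "w \<in> {y}"
    then show "z \<in> topspace X" using partial_homeos_topspace[OF \<Phi>_ph] by blast
    show "z \<notin> Y'" using Y'_step[OF \<Phi>_converse[OF \<phi>(1)], of z y] \<phi> assms by blast
  qed
  show "finite (topspace X - Y')" using Y'_cofinite by (simp add: cofinite_in_def)
qed

end

section \<open>From the globalization to the data \<open>\<Phi>\<close>, \<open>E\<close> and
  \<open>N\<close>\<close>

theorem theorem2p3:
  fixes A :: "'a topology" and S :: "('a \<times> 'a) set set"
    and X :: "'x topology" and \<H> :: "('x \<times> 'a) set set"
    and H :: "('x \<times> 'x) set set set"
  assumes "Hausdorff_space A"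
    and "\<forall>a\<in>topspace A. \<not> openin A {a}"
    and "pseudogroup A S"
    and "Hausdorff_space X"
    and "S_structure A S X \<H>"
    and "subgroup H (PC0 X \<H>)"
    and "transfixed ((PC X \<H>)\<lparr>carrier := H\<rparr>) X alpha_S"
  shows "\<exists>Y Y' \<K>. Y \<subseteq> Y' \<and> cofinite_in X Y \<and> cofinite_in X Y' \<and>
           invariant_subset X H Y' \<and>
           S_structure A S (subtopology X Y') \<K> \<and>
           invariant_structure X H \<K> \<and>
           structure_on \<K> Y = structure_on \<H> Y \<and>
           ((\<forall>x\<in>topspace X. infinite (orbit_of X H x)) \<longrightarrow> Y' = topspace X)"
proof -
  interpret S_modeled A S X \<H> by unfold_locales (use assms in auto)
  interpret P: group "PC0 X \<H>" by (rule group_PC0)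
  interpret H: subgroup H "PC0 X \<H>" by fact
  define G where "G = (PC X \<H>)\<lparr>carrier := H\<rparr>"
  \<comment> \<open>The transfixing hypothesis restricts \<open>PC\<close>, the subgroup hypothesis
    concerns \<open>PC0\<close>; with carrier \<open>H\<close> both give the same structure, so
    inverses can be computed in \<open>PC0\<close>.\<close>
  have "(PC0 X \<H>)\<lparr>carrier := H\<rparr> = G" by (simp add: G_def PC0_def)
  then have inv_G: "inv\<^bsub>G\<^esub> g = inv\<^bsub>PC0 X \<H>\<^esub> g" if "g \<in> H" for g
    using P.m_inv_consistent[OF assms(6) that] by simp
  have G [simp]: "carrier G = H" "mult G = mult (PC X \<H>)" "one G = one (PC X \<H>)"
    by (simp_all add: G_def)
  define \<Phi> where "\<Phi> = {\<phi> \<in> pieces. cls \<phi> \<in> H}"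
  have \<Phi>I: "\<phi> \<in> pieces" "cls \<phi> \<in> H" if "\<phi> \<in> \<Phi>" for \<phi> using that by (auto simp: \<Phi>_def)
  have H_eq: "H = cls ` \<Phi>" using H.subset unfolding \<Phi>_def carrier_PC0 by blast
  have \<Phi>_Id: "Id_on (topspace X) \<in> \<Phi>" using H.one_closed pieces_Id by (simp add: \<Phi>_def PC_one)
  have \<Phi>_conv: "\<phi>\<inverse> \<in> \<Phi>" if "\<phi> \<in> \<Phi>" for \<phi>
    using H.m_inv_closed[OF \<Phi>I(2)[OF that]] \<Phi>I(1)[OF that] pieces_converse
    by (simp add: \<Phi>_def inv_PC0_cls)
  have \<Phi>_comp: "\<phi> O \<psi> \<in> \<Phi>" if "\<phi> \<in> \<Phi>" "\<psi> \<in> \<Phi>" for \<phi> \<psi>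
    using H.m_closed[OF \<Phi>I(2)[OF that(2)] \<Phi>I(2)[OF that(1)]] \<Phi>I(1)[OF that(1)] \<Phi>I(1)[OF that(2)]
    by (simp add: \<Phi>_def PC_mult_cls pieces_relcomp)
  \<comment> \<open>The globalization relation in terms of self-homeomorphisms: the group element
    "inverse of \<open>\<psi>\<close> times \<open>\<phi>\<close>" is the relation
    \<open>\<phi> O \<psi>\<inverse>\<close>.\<close>
  have rel_iff: "((cls \<phi>, x), (cls \<psi>, y)) \<in> glob_rel G X alpha_S \<longleftrightarrow> (x, y) \<in> reg (\<phi> O \<psi>\<inverse>)"
    if "\<phi> \<in> \<Phi>" "\<psi> \<in> \<Phi>" for \<phi> \<psi> x y
  proof -
    have "inv\<^bsub>G\<^esub> (cls \<psi>) \<otimes>\<^bsub>G\<^esub> cls \<phi> = cls (\<phi> O \<psi>\<inverse>)"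
      using that \<Phi>I by (simp add: inv_G inv_PC0_cls PC_mult_cls pieces_converse)
    moreover have "\<phi> O \<psi>\<inverse> \<in> pieces" using that by (intro \<Phi>I \<Phi>_comp \<Phi>_conv)
    moreover then have "(x, y) \<in> reg (\<phi> O \<psi>\<inverse>) \<Longrightarrow> x \<in> topspace X \<and> y \<in> topspace X"
      using partial_homeos_topspace[OF self_homeosD(1)[OF piecesD]] reg_subset by blast
    ultimately show ?thesis using that \<Phi>I by (auto simp: glob_rel_def alpha_cls)
  qed
  define q where "q \<phi> x = glob_rel G X alpha_S `` {(cls \<phi>, x)}" for \<phi> x
  have q_iff: "(cls \<psi>, y) \<in> q \<phi> x \<longleftrightarrow> (x, y) \<in> reg (\<phi> O \<psi>\<inverse>)"
    if "\<phi> \<in> \<Phi>" "\<psi> \<in> \<Phi>" for \<phi> \<psi> x y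
    using rel_iff[OF that] by (simp add: q_def)
  have q_cases: "\<exists>\<psi>\<in>\<Phi>. k = cls \<psi>" if "(k, y) \<in> q \<phi> x" for k y \<phi> x
  proof -
    have "k \<in> H" using that by (simp add: q_def glob_rel_def)
    then show ?thesis using H_eq by blast
  qed
  let ?I = "Id_on (topspace X)"
  have embed: "glob_embed G X alpha_S x = q ?I x" for x
    by (simp add: glob_embed_def q_def PC_one)
  have reg_Id: "(x, x) \<in> reg ?I" if "x \<in> topspace X" for x
    using SP_Id that by (intro regI[of ?I]) auto
  have \<Phi>_ph: "\<phi> \<in> partial_homeos X X" if "\<phi> \<in> \<Phi>" for \<phi>
    using \<Phi>I(1)[OF that] piecesD self_homeosD(1) by blast
  have Id_O: "?I O \<phi> = \<phi>" "\<phi> O ?I = \<phi>" if "\<phi> \<in> \<Phi>" for \<phi>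
    using partial_homeos_subset[OF \<Phi>_ph[OF that]] by auto
  \<comment> \<open>\<open>glob_act\<close> is a union over all pairs in the class, whence the
    existential. Two consequences suffice below: the translate by \<open>\<phi>\<close> of the
    embedded \<open>x\<close> contains \<open>(cls \<phi>, x)\<close>, and all its pairs lie over
    the image of \<open>x\<close> under \<open>\<phi>\<close>.\<close>
  have act_iff: "(k, w) \<in> glob_act G X alpha_S (cls \<phi>) (q ?I x) \<longleftrightarrow>
      (\<exists>\<psi>\<in>\<Phi>. \<exists>z. (cls \<psi>, z) \<in> q ?I x \<and> (k, w) \<in> q (\<psi> O \<phi>) z)" if "\<phi> \<in> \<Phi>" for k w \<phi> x
  proof -
    have "cls \<phi> \<otimes>\<^bsub>G\<^esub> cls \<psi> = cls (\<psi> O \<phi>)" if "\<psi> \<in> \<Phi>" for \<psi>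
      using that \<open>\<phi> \<in> \<Phi>\<close> \<Phi>I by (simp add: PC_mult_cls)
    then have q_eq: "glob_rel G X alpha_S `` {(cls \<phi> \<otimes>\<^bsub>G\<^esub> cls \<psi>, z)} = q (\<psi> O \<phi>) z" if "\<psi> \<in> \<Phi>" for \<psi> z
      using that by (simp add: q_def)
    have "(k, w) \<in> glob_act G X alpha_S (cls \<phi>) (q ?I x) \<longleftrightarrow>
      (\<exists>h z. (h, z) \<in> q ?I x \<and> (k, w) \<in> glob_rel G X alpha_S `` {(cls \<phi> \<otimes>\<^bsub>G\<^esub> h, z)})"
      unfolding glob_act_def by blast
    also have "\<dots> \<longleftrightarrow> (\<exists>\<psi>\<in>\<Phi>. \<exists>z. (cls \<psi>, z) \<in> q ?I x \<and> (k, w) \<in> q (\<psi> O \<phi>) z)"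
      using q_cases q_eq by metis
    finally show ?thesis .
  qed
  have O_conv_Id: "?I O \<phi>\<inverse> = \<phi>\<inverse>" if "\<phi> \<in> \<Phi>" for \<phi>
    using Id_O(1)[OF \<Phi>_conv[OF that]] .
  have Id_in_q: "(cls ?I, x) \<in> q ?I x" if "x \<in> topspace X" for x
    using reg_Id[OF that] q_iff[OF \<Phi>_Id \<Phi>_Id] O_conv_Id[OF \<Phi>_Id] by simp
  have act_base: "(cls \<phi>, x) \<in> glob_act G X alpha_S (cls \<phi>) (q ?I x)"
    if "\<phi> \<in> \<Phi>" "x \<in> topspace X" for \<phi> x
  proof -
    have "\<phi> O \<phi>\<inverse> = ?I" using \<Phi>I(1)[OF that(1)] by (intro self_homeosD(2) piecesD)
    then have "(cls \<phi>, x) \<in> q (?I O \<phi>) x"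
      using q_iff[OF that(1,1)] reg_Id[OF that(2)] Id_O(1)[OF that(1)] by simp
    then show ?thesis using act_iff[OF that(1)] Id_in_q[OF that(2)] \<Phi>_Id by blast
  qed
  \<comment> \<open>Equivariance of the projection to \<open>X\<close>: a pair
    \<open>(cls \<psi>, w)\<close> in the translate has the same image under \<open>\<psi>\<close>
    as \<open>x\<close> has under \<open>\<phi>\<close>.\<close>
  have act_point: "\<exists>\<psi>\<in>\<Phi>. k = cls \<psi> \<and> (x, w) \<in> \<phi> O \<psi>\<inverse>"
    if \<phi>: "\<phi> \<in> \<Phi>" and kw: "(k, w) \<in> glob_act G X alpha_S (cls \<phi>) (q ?I x)" for \<phi> x k w
  proof -
    obtain \<theta> z where \<theta>: "\<theta> \<in> \<Phi>" "(cls \<theta>, z) \<in> q ?I x" "(k, w) \<in> q (\<theta> O \<phi>) z"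
      using kw act_iff[OF \<phi>] by blast
    obtain \<psi> where \<psi>: "\<psi> \<in> \<Phi>" "k = cls \<psi>" using q_cases[OF \<theta>(3)] by blast
    have "(x, z) \<in> ?I O \<theta>\<inverse>" using q_iff[OF \<Phi>_Id \<theta>(1)] \<theta>(2) reg_subset by blast
    then have xz: "(z, x) \<in> \<theta>" by blast
    have "(z, w) \<in> (\<theta> O \<phi>) O \<psi>\<inverse>"
      using q_iff[OF \<Phi>_comp[OF \<theta>(1) \<phi>] \<psi>(1)] \<theta>(3) \<psi>(2) reg_subset by blast
    then obtain x' v where "(z, x') \<in> \<theta>" "(x', v) \<in> \<phi>" "(w, v) \<in> \<psi>" by blast
    moreover from this have "x' = x" using partial_homeos_sv[OF \<Phi>_ph[OF \<theta>(1)]] xz by blast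
    ultimately have "(x, w) \<in> \<phi> O \<psi>\<inverse>" by blast
    with \<psi> show ?thesis by (intro bexI[of _ \<psi>] conjI)
  qed
  obtain X0 where X0_eq: "\<forall>g\<in>carrier G. glob_act G X alpha_S g ` X0 = X0"
    and fin: "finite (sym_diff (glob_embed G X alpha_S ` topspace X) X0)"
    using assms(7) unfolding transfixed_def G_def[symmetric] by (elim exE conjE)
  have X0: "glob_act G X alpha_S g c \<in> X0" if "g \<in> H" "c \<in> X0" for g c
    using X0_eq that unfolding G by (metis imageI)
  define E where "E = {x \<in> topspace X. q ?I x \<in> X0}"
  define N where "N = {y. \<exists>\<phi>\<in>\<Phi>. \<exists>x\<in>E. (x, y) \<in> \<phi> - reg \<phi>}"
  have E_cofinite: "cofinite_in X E"
  proof -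
    \<comment> \<open>\<open>X\<close> embeds injectively since \<open>reg ?I\<close> lies in the
      identity; so points outside \<open>E\<close> inject into the finite set of embedded points
      missing from \<open>X0\<close>.\<close>
    have "inj_on (q ?I) (topspace X - E)"
    proof (rule inj_onI)
      fix x x' assume "x \<in> topspace X - E" "x' \<in> topspace X - E" "q ?I x = q ?I x'"
      then have "(cls ?I, x) \<in> q ?I x'" using Id_in_q by blast
      then show "x = x'" using q_iff[OF \<Phi>_Id \<Phi>_Id] reg_subset by blast
    qed
    moreover have "q ?I ` (topspace X - E) \<subseteq> sym_diff (glob_embed G X alpha_S ` topspace X) X0"
      unfolding E_def embed by auto
    then have "finite (q ?I ` (topspace X - E))" using fin by (rule finite_subset)
    ultimately have "finite (topspace X - E)" by (rule finite_imageD[rotated])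
    then show ?thesis by (auto simp: cofinite_in_def E_def)
  qed
  have N_finite: "finite N"
  proof (rule finite_subset)
    \<comment> \<open>\<open>p\<close> is the projection sending the class of
      \<open>(\<psi>, w)\<close> to the image of \<open>w\<close> under \<open>\<psi>\<close>. The
      choice is shown to be determined just for the translates used here.\<close>
    define p where "p c = (SOME y. \<exists>\<psi>\<in>\<Phi>. \<exists>w. (cls \<psi>, w) \<in> c \<and> (w, y) \<in> \<psi>)"
      for c :: "(('x \<times> 'x) set set \<times> 'x) set"
    show "finite (p ` (X0 - q ?I ` topspace X))"
      using fin unfolding embed by simp
    show "N \<subseteq> p ` (X0 - q ?I ` topspace X)"
    proof
      fix y assume "y \<in> N"
      then obtain \<phi> x where \<phi>: "\<phi> \<in> \<Phi>" and x: "x \<in> E" and xy: "(x, y) \<in> \<phi>" "(x, y) \<notin> reg \<phi>"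
        unfolding N_def by blast
      define c where "c = glob_act G X alpha_S (cls \<phi>) (q ?I x)"
      have xX: "x \<in> topspace X" and "q ?I x \<in> X0" using x by (auto simp: E_def)
      then have "c \<in> X0" unfolding c_def using X0 \<Phi>I(2)[OF \<phi>] by blast
      have base: "(cls \<phi>, x) \<in> c" unfolding c_def using \<phi> xX by (rule act_base)
      \<comment> \<open>If the translate were an embedded point, \<open>\<phi>\<close> would be
        regular at \<open>x\<close>. So \<open>c\<close> is one of the finitely many classes of
        \<open>X0\<close> outside \<open>X\<close>.\<close>
      have "c \<noteq> q ?I x'" for x'
      proof
        assume "c = q ?I x'"
        then have "(x', x) \<in> reg (\<phi>\<inverse>)" using base q_iff[OF \<Phi>_Id \<phi>] O_conv_Id[OF \<phi>] by simp
        then have "(x, x') \<in> reg \<phi>" using reg_converse by fastforce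
        moreover from this have "x' = y"
          using reg_subset partial_homeos_sv[OF \<Phi>_ph[OF \<phi>] _ xy(1)] by blast
        ultimately show False using xy(2) by simp
      qed
      moreover have "p c = y"
        unfolding p_def
      proof (rule some_equality)
        show "\<exists>\<psi>\<in>\<Phi>. \<exists>w. (cls \<psi>, w) \<in> c \<and> (w, y) \<in> \<psi>" using \<phi> base xy(1) by blast
        fix y' assume "\<exists>\<psi>\<in>\<Phi>. \<exists>w. (cls \<psi>, w) \<in> c \<and> (w, y') \<in> \<psi>"
        then obtain \<psi> w where \<psi>: "\<psi> \<in> \<Phi>" "(cls \<psi>, w) \<in> c" "(w, y') \<in> \<psi>" by blast
        then obtain \<psi>' where "\<psi>' \<in> \<Phi>" "cls \<psi> = cls \<psi>'" and w: "(x, w) \<in> \<phi> O \<psi>'\<inverse>"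
          using act_point[OF \<phi>] unfolding c_def by blast
        then have "\<psi>' = \<psi>" using \<psi>(1) \<Phi>I(1) cls_inj by metis
        then obtain v where "(x, v) \<in> \<phi>" "(w, v) \<in> \<psi>" using w by blast
        then show "y' = y"
          using \<psi>(3) xy(1) partial_homeos_sv[OF \<Phi>_ph[OF \<phi>]] partial_homeos_sv[OF \<Phi>_ph[OF \<psi>(1)]] by blast
      qed
      ultimately show "y \<in> p ` (X0 - q ?I ` topspace X)" using \<open>c \<in> X0\<close> by blast
    qed
  qed
  interpret T: transfixing A S X \<H> \<Phi> E N
    by unfold_locales
      (use N_def \<Phi>I \<Phi>_Id \<Phi>_conv \<Phi>_comp E_cofinite N_finite in auto)
  have act_\<Phi>: "PC0_act X h \<in> \<Phi>" if "h \<in> H" for h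
    using that \<Phi>I(1) PC0_act_cls by (auto simp: H_eq)
  have "invariant_subset X H T.Y'"
    unfolding invariant_subset_def using act_\<Phi> T.Y'_Image by blast
  moreover have "invariant_structure X H T.K"
    unfolding invariant_structure_def using act_\<Phi> T.K_invariant by blast
  moreover have "T.Y' = topspace X" if "\<forall>x\<in>topspace X. infinite (orbit_of X H x)"
  proof (rule ccontr)
    assume "T.Y' \<noteq> topspace X"
    then obtain y where y: "y \<in> topspace X - T.Y'" using T.Y'_topspace by blast
    have "orbit_of X H y \<subseteq> (\<Union>\<phi>\<in>\<Phi>. \<phi> `` {y})" unfolding orbit_of_def using act_\<Phi> by blast
    then have "finite (orbit_of X H y)" using T.finite_orbit[OF y] by (rule finite_subset)
    then show False using that y by blast
  qed
  ultimately show ?thesis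
    using T.Y_subset_Y' T.Y_cofinite T.Y'_cofinite T.K_structure T.K_on_Y
    by (intro exI[of _ T.Y] exI[of _ T.Y'] exI[of _ T.K] conjI impI)
qed

end
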